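(* Let $\Phi^*$ be a sparsest phase solution to the (noise-free) sparse phase retrieval problem, i.e. a phase solution with $\|\Phi^*\|_0$ minimal among all phase solutions, and let $s=\|\Phi^*\|_0$ (this value of $s$ is the one used in $\Omega_3$). Put $x^*=\chi\odot\exp(j\Phi^* )$. Suppose that the set-valued mapping $\Psi=\mathrm{Id}-T$, where $T=P_{\Omega_3}P_{\Omega_2}P_{\Omega_1}$, is metrically subregular at $x^*$ for $0$, i.e. there are constants $\kappa>0$ and $\delta>0$ such that $$\kappa\,\mathrm{dist}(x,\Psi^{-1}(0))\le\mathrm{dist}(0,\Psi(x))\qquad\forall x\in\mathbb{B}_\delta(x^* ).$$ Then every iterative sequence $(x_k)$ generated by $T$ (that is, $x_{k+1}\in T(x_k)$ for all $k\in\mathbb{N}$) converges R-linearly to a point of $\Omega_1\cap\Omega_2\cap\Omega_3$ (equivalently, to a solution of the sparse phase retrieval problem), provided that the initial point $x_0$ is sufficiently close to $x^*$.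
   Context: The underlying space is $\mathbb{C}^{n\times n}$ with the Frobenius norm $\|\cdot\|$; $j$ is the imaginary unit; $\odot$ is element-wise multiplication; $\exp$, $|\cdot|$, $|\cdot|^2$ and $\arg$ are applied element-wise, with $\arg$ taking values in $(-\pi,\pi]$; $\|\cdot\|_0$ is the number of nonzero entries; $\mathbb{B}_\delta(x)$ is the open ball of radius $\delta$ centered at $x$; $\mathrm{dist}(x,\Omega)=\inf_{w\in\Omega}\|x-w\|$. $\mathcal{F}$ is the discrete two-dimensional Fourier transform on $\mathbb{C}^{n\times n}$ (normalized so as to be unitary, or any fixed nonzero scalar multiple of that). Given data: $\chi\in\mathbb{R}_+^{n\times n}$ uniform, i.e. all entries equal the same constant $r>0$; $\Phi^d\in\mathbb{R}^{n\times n}$; $b\in\mathbb{R}_+^{n\times n}$. Noise-free sparse phase retrieval problem with sparsity bound $s$: find $\Phi\in(-\pi,\pi]^{n\times n}$ such that $|\mathcal{F}(\chi\odot\exp(j(\Phi^d+\Phi)))|^2=b$ and $\|\Phi\|_0\le s$; such a $\Phi$ is called a phase solution. "Sparsest phase solution" means a $\Phi\in(-\pi,\pi]^{n\times n}$ with $|\mathcal{F}(\chi\odot\exp(j(\Phi^d+\Phi)))|^2=b$ and with $\|\Phi\|_0$ smallest possible. Constraint sets: $\Omega_1=\{x\in\mathbb{C}^{n\times n}: |\mathcal{F}(x\odot\exp(j\Phi^d))|^2=b\}$, $\Omega_2=\{x\in\mathbb{C}^{n\times n}: |x|=\chi\}$, $\Omega_3=\{x\in\Omega_2: \|\arg(x)\|_0\le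 s\}$. Thus $x\in\Omega_1\cap\Omega_2\cap\Omega_3$ if and only if $x=\chi\odot\exp(j\Phi)$ with $\Phi$ a phase solution. For a set $\Omega$, $P_\Omega(x)=\{w\in\Omega: \|x-w\|=\mathrm{dist}(x,\Omega)\}$ (set-valued). $T(x)=P_{\Omega_3}P_{\Omega_2}P_{\Omega_1}(x)$ is the set of all $w$ for which there exist $y\in P_{\Omega_1}(x)$ and $z\in P_{\Omega_2}(y)$ with $w\in P_{\Omega_3}(z)$. $\Psi(x)=\{x-w: w\in T(x)\}$ and $\Psi^{-1}(0)=\{x: 0\in\Psi(x)\}=\{x: x\in T(x)\}$. (The map $T$ is the iteration map of the SROP algorithm, which is the Gerchberg–Saxton iteration followed by setting to zero all but $s$ largest-magnitude entries of the phase.) A sequence $(x_k)$ converges R-linearly to $\bar x$ with rate $c\in[0,1)$ if there is $\gamma>0$ with $\|x_k-\bar x\|\le\gamma c^k$ for all $k\in\mathbb{N}$; it converges R-linearly if this holds for some $c\in[0,1)$. *)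

theory Defs
  imports "HOL-Analysis.Analysis"
begin

text \<open>
  Matrices are elements of \<open>'a^'n^'n\<close>. The library norm on \<open>complex^'n^'n\<close> is the Euclidean norm
  of the Euclidean norms of the rows, i.e. the Frobenius norm; \<open>dist\<close>, \<open>ball\<close>, \<open>infdist\<close> refer to it.
  Element-wise application of a function is the library's \<open>map_matrix\<close>.
\<close>

definition hadamard :: "'a::times^'n^'n \<Rightarrow> 'a^'n^'n \<Rightarrow> 'a^'n^'n" (infixl "\<odot>" 70) where
  "A \<odot> B = (\<chi> p q. A $ p $ q * B $ p $ q)"

definition expj :: "real^'n^'n \<Rightarrow> complex^'n^'n" where
  "expj \<Phi> = map_matrix (\<lambda>t. exp (\<i> * complex_of_real t)) \<Phi>"

definition l0 :: "'a::zero^'n^'n \<Rightarrow> nat" where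
  "l0 A = card {(p, q). A $ p $ q \<noteq> 0}"

text \<open>
  The index type \<open>'n\<close> carries no arithmetic, so the transform is taken relative to a numbering \<open>idx\<close>
  of the indices by \<open>0, \<dots>, n - 1\<close> (bijectivity is assumed where the transform is used).
  For \<open>c = 1\<close> the transform is unitary; \<open>c\<close> is the scalar multiple.
\<close>

definition dft2 :: "('n \<Rightarrow> nat) \<Rightarrow> complex \<Rightarrow> complex^'n^'n \<Rightarrow> complex^'n^'n" where
  "dft2 idx c x = (\<chi> p q. c / of_nat CARD('n) * (\<Sum>k\<in>UNIV. \<Sum>l\<in>UNIV. x $ k $ l *
     exp (- (2 * of_real pi * \<i> * of_nat (idx p * idx k + idx q * idx l) / of_nat CARD('n)))))"

text \<open>
  In the following, \<open>F\<close> is the transform, \<open>X\<close> the amplitude \<open>\<chi>\<close> (whose name is reserved for the vector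
  binder), \<open>\<Phi>d\<close> and \<open>b\<close> the remaining data.
\<close>

definition phase_feasible ::
  "(complex^'n^'n \<Rightarrow> complex^'n^'n) \<Rightarrow> real^'n^'n \<Rightarrow> real^'n^'n \<Rightarrow> real^'n^'n \<Rightarrow> real^'n^'n \<Rightarrow> bool" where
  "phase_feasible F X \<Phi>d b \<Phi> \<longleftrightarrow>
     (\<forall>p q. \<Phi> $ p $ q \<in> {-pi<..pi}) \<and>
     map_matrix (\<lambda>z. (cmod z)\<^sup>2) (F (map_matrix of_real X \<odot> expj (\<Phi>d + \<Phi>))) = b"

definition phase_solution ::
  "(complex^'n^'n \<Rightarrow> complex^'n^'n) \<Rightarrow> real^'n^'n \<Rightarrow> real^'n^'n \<Rightarrow> real^'n^'n \<Rightarrow> nat \<Rightarrow> real^'n^'n \<Rightarrow> bool" where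
  "phase_solution F X \<Phi>d b s \<Phi> \<longleftrightarrow> phase_feasible F X \<Phi>d b \<Phi> \<and> l0 \<Phi> \<le> s"

definition sparsest_phase_solution ::
  "(complex^'n^'n \<Rightarrow> complex^'n^'n) \<Rightarrow> real^'n^'n \<Rightarrow> real^'n^'n \<Rightarrow> real^'n^'n \<Rightarrow> real^'n^'n \<Rightarrow> bool" where
  "sparsest_phase_solution F X \<Phi>d b \<Phi> \<longleftrightarrow>
     phase_feasible F X \<Phi>d b \<Phi> \<and> (\<forall>\<Theta>. phase_feasible F X \<Phi>d b \<Theta> \<longrightarrow> l0 \<Phi> \<le> l0 \<Theta>)"

definition \<Omega>1 ::
  "(complex^'n^'n \<Rightarrow> complex^'n^'n) \<Rightarrow> real^'n^'n \<Rightarrow> real^'n^'n \<Rightarrow> (complex^'n^'n) set" where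
  "\<Omega>1 F \<Phi>d b = {x. map_matrix (\<lambda>z. (cmod z)\<^sup>2) (F (x \<odot> expj \<Phi>d)) = b}"

definition \<Omega>2 :: "real^'n^'n \<Rightarrow> (complex^'n^'n) set" where
  "\<Omega>2 X = {x. map_matrix cmod x = X}"

text \<open>The library's \<open>Arg\<close> takes values in \<open>(-\<pi>, \<pi>]\<close>.\<close>

definition \<Omega>3 :: "real^'n^'n \<Rightarrow> nat \<Rightarrow> (complex^'n^'n) set" where
  "\<Omega>3 X s = {x \<in> \<Omega>2 X. l0 (map_matrix Arg x) \<le> s}"

definition proj :: "'a::metric_space set \<Rightarrow> 'a \<Rightarrow> 'a set" where
  "proj S x = {w \<in> S. dist x w = infdist x S}"

definition T ::
  "(complex^'n^'n \<Rightarrow> complex^'n^'n) \<Rightarrow> real^'n^'n \<Rightarrow> real^'n^'n \<Rightarrow> real^'n^'n \<Rightarrow> nat \<Rightarrow>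
     complex^'n^'n \<Rightarrow> (complex^'n^'n) set" where
  "T F X \<Phi>d b s x = {w. \<exists>y \<in> proj (\<Omega>1 F \<Phi>d b) x. \<exists>z \<in> proj (\<Omega>2 X) y. w \<in> proj (\<Omega>3 X s) z}"

definition id_minus :: "('a::minus \<Rightarrow> 'a set) \<Rightarrow> 'a \<Rightarrow> 'a set" where
  "id_minus S x = {x - w | w. w \<in> S x}"

text \<open>
  \<open>metrically_subregular \<Psi> xb yb\<close>: the set-valued map \<open>\<Psi>\<close> is metrically subregular at \<open>xb\<close> for \<open>yb\<close>.
  The library sets \<open>infdist x {} = 0\<close>, whereas the usual convention is \<open>\<infinity>\<close>. The difference is
  immaterial when \<open>\<Psi>\<close> has nonempty values and \<open>yb \<in> \<Psi> xb\<close>, as for the map \<open>Id - T\<close> when a phase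
  solution exists: the three sets are then closed and nonempty, so projections onto them exist.
\<close>

definition metrically_subregular ::
  "('a::metric_space \<Rightarrow> 'b::metric_space set) \<Rightarrow> 'a \<Rightarrow> 'b \<Rightarrow> bool" where
  "metrically_subregular \<Psi> xb yb \<longleftrightarrow>
     (\<exists>\<kappa>>0. \<exists>\<delta>>0. \<forall>x \<in> ball xb \<delta>. \<kappa> * infdist x {u. yb \<in> \<Psi> u} \<le> infdist yb (\<Psi> x))"

definition R_linearly_converges :: "(nat \<Rightarrow> 'a::real_normed_vector) \<Rightarrow> 'a \<Rightarrow> bool" where
  "R_linearly_converges x xb \<longleftrightarrow>
     (\<exists>c \<in> {0..<1::real}. \<exists>\<gamma>>0. \<forall>k. norm (x k - xb) \<le> \<gamma> * c ^ k)"

lemma expj_add: "X \<odot> expj (\<Phi> + \<Theta>) = X \<odot> expj \<Theta> \<odot> expj \<Phi>"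
  by (simp add: vec_eq_iff hadamard_def expj_def ring_distribs exp_add mult_ac)

text \<open>The common points of the three sets are exactly the encodings of the phase solutions.\<close>

lemma in_\<Omega>_iff_phase_solution:
  assumes "\<And>p q. X $ p $ q > 0"
  shows "x \<in> \<Omega>1 F \<Phi>d b \<inter> \<Omega>2 X \<inter> \<Omega>3 X s \<longleftrightarrow>
    (\<exists>\<Phi>. phase_solution F X \<Phi>d b s \<Phi> \<and> x = map_matrix of_real X \<odot> expj \<Phi>)"
proof
  assume x: "x \<in> \<Omega>1 F \<Phi>d b \<inter> \<Omega>2 X \<inter> \<Omega>3 X s"
  define \<Phi> where "\<Phi> = map_matrix Arg x"
  have "x $ p $ q = of_real (cmod (x $ p $ q)) * exp (\<i> * of_real (Arg (x $ p $ q)))" for p q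
    by (metis Arg_zero cis_conv_exp is_Arg_def norm_zero mult_zero_left of_real_0 rcis_cmod_Arg rcis_def)
  moreover have "map_matrix cmod x = X"
    using x by (simp add: \<Omega>2_def)
  ultimately have eq: "x = map_matrix of_real X \<odot> expj \<Phi>"
    by (auto simp: vec_eq_iff hadamard_def expj_def \<Phi>_def)
  have "phase_solution F X \<Phi>d b s \<Phi>"
    using x Arg_bounded unfolding phase_solution_def phase_feasible_def expj_add eq[symmetric]
    by (simp add: \<Omega>1_def \<Omega>3_def \<Phi>_def)
  with eq show "\<exists>\<Phi>. phase_solution F X \<Phi>d b s \<Phi> \<and> x = map_matrix of_real X \<odot> expj \<Phi>"
    by blast
next
  assume "\<exists>\<Phi>. phase_solution F X \<Phi>d b s \<Phi> \<and> x = map_matrix of_real X \<odot> expj \<Phi>"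
  then obtain \<Phi> where \<Phi>: "phase_solution F X \<Phi>d b s \<Phi>" and eq: "x = map_matrix of_real X \<odot> expj \<Phi>"
    by blast
  have "map_matrix cmod x = X"
    using assms by (simp add: eq vec_eq_iff hadamard_def expj_def norm_mult less_imp_le)
  moreover have "map_matrix Arg x = \<Phi>"
  proof -
    have "Arg (x $ p $ q) = \<Phi> $ p $ q" for p q
    proof (rule cis_Arg_unique)
      show "sgn (x $ p $ q) = cis (\<Phi> $ p $ q)"
        using assms[of p q] by (simp add: eq hadamard_def expj_def sgn_div_norm norm_mult cis_conv_exp scaleR_conv_of_real)
    qed (use \<Phi> in \<open>auto simp: phase_solution_def phase_feasible_def\<close>)
    then show ?thesis by (simp add: vec_eq_iff)
  qed
  moreover have "x \<in> \<Omega>1 F \<Phi>d b"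
    using \<Phi> by (simp add: \<Omega>1_def phase_solution_def phase_feasible_def expj_add eq)
  ultimately show "x \<in> \<Omega>1 F \<Phi>d b \<inter> \<Omega>2 X \<inter> \<Omega>3 X s"
    using \<Phi> by (simp add: \<Omega>2_def \<Omega>3_def phase_solution_def)
qed

end

theory Submission
  imports Defs
begin

text \<open>
  Near \<open>xs\<close> the iteration is an alternating projection between two smooth sets. Up to a similarity, \<open>\<Omega>1\<close> is
  a product of circles (of radii \<open>sqrt b\<close>, some of them possibly points), because the Fourier transform
  is a multiple of a unitary map. Phases that are nonzero at \<open>xs\<close> stay nonzero nearby, so the sparsity bound,
  attained at \<open>xs\<close>, forces the remaining phases to vanish: near \<open>xs\<close> the set \<open>\<Omega>3\<close> is a product \<open>C\<close> of circles
  and points (\<open>\<Omega>3_locally_circles_and_points\<close>), and projecting onto \<open>\<Omega>2\<close> and then onto \<open>\<Omega>3\<close> is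
  projecting onto \<open>C\<close>.

  For a circle, the Pythagorean identity for the nearest point holds with a relative error that tends to zero
  at the circle (\<open>sphere_pythagoras\<close>). This passes to products and to preimages under similarities, and
  yields, for points \<open>p\<close> of \<open>\<Omega>1 \<inter> C\<close>, that one iteration from \<open>y\<close> to \<open>w\<close> decreases the squared distance to
  \<open>p\<close> by almost \<open>|y - w|\<^sup>2 / 2\<close>. Metric subregularity bounds \<open>|y - w|\<close> below by \<open>\<kappa>\<close> times the distance to the
  fixed points. If the fixed points near \<open>xs\<close> all lie in \<open>\<Omega>1 \<inter> C\<close>, the distance to them contracts, and
  convergence is R-linear (\<open>contracting_distance_imp_linear_convergence\<close>).

  It remains to exclude fixed points near \<open>xs\<close> outside the intersection. Alternating projections can be
  stationary at the ends of a locally shortest segment between two disjoint parts of the sets, and a sequence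
  that starts there never leaves. Metric subregularity excludes this: it makes the set of fixed points
  almost midpoint convex near \<open>xs\<close>, while the squared distance to \<open>\<Omega>1\<close> varies only quadratically between fixed points, and by successive bisection it
  is constant on them (\<open>constant_if_quadratic_and_almost_midpoint_convex\<close>). Its value at \<open>xs\<close> is zero.
  The argument is carried out for general pairs of sets in \<open>alternating_projections_linear_convergence\<close>.
\<close>

section \<open>Strict derivatives\<close>

text \<open>
  Strict differentiability: the linear approximation of a difference of values holds with both points
  varying. Unlike the derivative at a point, it compares the value at a midpoint with the values at the end
  points, up to an error that is small relative to their distance.
\<close>

definition has_strict_derivative ::
  "('a::real_normed_vector \<Rightarrow> 'b::real_normed_vector) \<Rightarrow> ('a \<Rightarrow> 'b) \<Rightarrow> 'a \<Rightarrow> bool" where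
  "has_strict_derivative f D x \<longleftrightarrow> bounded_linear D \<and>
     (\<forall>e>0. \<forall>\<^sub>F z in nhds (x, x).
        norm (f (fst z) - f (snd z) - D (fst z - snd z)) \<le> e * norm (fst z - snd z))"

lemma has_strict_derivativeD:
  assumes "has_strict_derivative f D x" and "e > 0"
  shows "\<forall>\<^sub>F z in nhds (x, x).
    norm (f (fst z) - f (snd z) - D (fst z - snd z)) \<le> e * norm (fst z - snd z)"
  using assms unfolding has_strict_derivative_def by blast

lemma strict_derivative_const: "has_strict_derivative (\<lambda>_. c) (\<lambda>_. 0) x"
  by (simp add: has_strict_derivative_def)

lemma strict_derivative_linear: "bounded_linear f \<Longrightarrow> has_strict_derivative f f x"
  by (simp add: has_strict_derivative_def linear_diff bounded_linear.linear)

text \<open>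
  The bound is the one for the error \<open>e = 1\<close>, plus the norm of the derivative.
\<close>

lemma strict_derivative_imp_Lipschitz:
  assumes "has_strict_derivative f D x"
  obtains M where "M > 0"
    "\<forall>\<^sub>F z in nhds (x, x). norm (f (fst z) - f (snd z)) \<le> M * norm (fst z - snd z)"
proof -
  have D: "bounded_linear D" using assms by (simp add: has_strict_derivative_def)
  have ev: "\<forall>\<^sub>F z in nhds (x, x). norm (f (fst z) - f (snd z) - D (fst z - snd z)) \<le> 1 * norm (fst z - snd z)"
    using assms zero_less_one by (rule has_strict_derivativeD)
  from D obtain K where K: "K > 0" "\<And>h. norm (D h) \<le> norm h * K"
    by (meson bounded_linear.pos_bounded)
  show ?thesis
  proof
    show "\<forall>\<^sub>F z in nhds (x, x). norm (f (fst z) - f (snd z)) \<le> (K + 1) * norm (fst z - snd z)"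
      using ev
    proof eventually_elim
      case (elim z)
      have "norm (f (fst z) - f (snd z)) \<le>
          norm (f (fst z) - f (snd z) - D (fst z - snd z)) + norm (D (fst z - snd z))"
        using norm_triangle_ineq[of "f (fst z) - f (snd z) - D (fst z - snd z)" "D (fst z - snd z)"] by simp
      also have "\<dots> \<le> 1 * norm (fst z - snd z) + norm (fst z - snd z) * K"
        using elim K(2) by (intro add_mono)
      finally show ?case by (simp add: algebra_simps)
    qed
  qed (use K in simp)
qed

lemma strict_derivative_imp_isCont:
  assumes "has_strict_derivative f D x"
  shows "isCont f x"
proof -
  obtain M where M: "M > 0"
    "\<forall>\<^sub>F z in nhds (x, x). norm (f (fst z) - f (snd z)) \<le> M * norm (fst z - snd z)"
    using strict_derivative_imp_Lipschitz[OF assms] .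
  have "filterlim (\<lambda>a. (a, x)) (nhds (x, x)) (at x)"
    by (intro tendsto_intros)
  with M(2) have "\<forall>\<^sub>F a in at x. norm (f a - f x) \<le> norm (a - x) * M"
    by (auto dest: eventually_compose_filterlim simp: mult.commute)
  then have "((\<lambda>a. f a - f x) \<longlongrightarrow> 0) (at x)"
    by (rule tendsto_0_le[rotated]) (simp add: LIM_zero_iff)
  then show ?thesis by (simp add: isCont_def LIM_zero_iff)
qed

lemma filterlim_Pair_isCont:
  assumes "isCont f x"
  shows "filterlim (\<lambda>z. (f (fst z), f (snd z))) (nhds (f x, f x)) (nhds (x, x))"
proof -
  have f: "filterlim f (nhds (f x)) (nhds x)"
    using assms by (simp add: continuous_within tendsto_at_iff_tendsto_nhds)
  show ?thesis
    unfolding nhds_prod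
    by (rule filterlim_Pair[OF filterlim_compose[OF f filterlim_fst] filterlim_compose[OF f filterlim_snd]])
qed

lemma strict_derivative_compose:
  assumes f: "has_strict_derivative f D x" and g: "has_strict_derivative g E (f x)"
  shows "has_strict_derivative (\<lambda>y. g (f y)) (\<lambda>h. E (D h)) x"
  unfolding has_strict_derivative_def
proof (intro conjI allI impI)
  have D: "bounded_linear D" and E: "bounded_linear E"
    using f g by (simp_all add: has_strict_derivative_def)
  then show "bounded_linear (\<lambda>h. E (D h))" by (rule bounded_linear_compose[rotated])
  obtain M where M: "M > 0"
    "\<forall>\<^sub>F z in nhds (x, x). norm (f (fst z) - f (snd z)) \<le> M * norm (fst z - snd z)"
    using strict_derivative_imp_Lipschitz[OF f] .
  from E obtain K where K: "K > 0" "\<And>h. norm (E h) \<le> norm h * K"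
    by (meson bounded_linear.pos_bounded)
  fix e :: real assume "e > 0"
  have 1: "\<forall>\<^sub>F z in nhds (x, x).
      norm (f (fst z) - f (snd z) - D (fst z - snd z)) \<le> e / (2 * K) * norm (fst z - snd z)"
    using f by (rule has_strict_derivativeD) (use \<open>e > 0\<close> \<open>K > 0\<close> in simp)
  have "\<forall>\<^sub>F z in nhds (f x, f x).
      norm (g (fst z) - g (snd z) - E (fst z - snd z)) \<le> e / (2 * M) * norm (fst z - snd z)"
    using g by (rule has_strict_derivativeD) (use \<open>e > 0\<close> \<open>M > 0\<close> in simp)
  from eventually_compose_filterlim[OF this filterlim_Pair_isCont[OF strict_derivative_imp_isCont[OF f]]]
  have 2: "\<forall>\<^sub>F z in nhds (x, x). norm (g (f (fst z)) - g (f (snd z)) - E (f (fst z) - f (snd z)))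
      \<le> e / (2 * M) * norm (f (fst z) - f (snd z))"
    by simp
  show "\<forall>\<^sub>F z in nhds (x, x). norm (g (f (fst z)) - g (f (snd z)) - E (D (fst z - snd z)))
      \<le> e * norm (fst z - snd z)"
    using 1 2 M(2)
  proof eventually_elim
    case (elim z)
    define h where "h = fst z - snd z"
    define k where "k = f (fst z) - f (snd z)"
    have "norm (g (f (fst z)) - g (f (snd z)) - E (D h)) \<le>
        norm (g (f (fst z)) - g (f (snd z)) - E k) + norm (E (k - D h))"
      using norm_triangle_ineq[of "g (f (fst z)) - g (f (snd z)) - E k" "E (k - D h)"]
      by (simp add: linear_diff[OF bounded_linear.linear[OF E]])
    also have "\<dots> \<le> e / (2 * M) * norm k + norm (k - D h) * K"
      using elim K(2) by (intro add_mono) (simp_all add: k_def)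
    also have "\<dots> \<le> e / (2 * M) * (M * norm h) + (e / (2 * K) * norm h) * K"
      using elim \<open>e > 0\<close> \<open>M > 0\<close> \<open>K > 0\<close> by (intro add_mono mult_left_mono mult_right_mono) (simp_all add: k_def h_def)
    also have "\<dots> = e * norm h"
      using \<open>M > 0\<close> \<open>K > 0\<close> by (simp add: field_simps)
    finally show ?case by (simp add: h_def)
  qed
qed

lemma strict_derivative_vec:
  fixes f :: "'n::finite \<Rightarrow> 'a::euclidean_space \<Rightarrow> 'b::euclidean_space"
  assumes "\<And>i. has_strict_derivative (f i) (D i) (x $ i)"
  shows "has_strict_derivative (\<lambda>y. \<chi> i. f i (y $ i)) (\<lambda>h. \<chi> i. D i (h $ i)) x"
  unfolding has_strict_derivative_def
proof (intro conjI allI impI)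
  have D: "bounded_linear (D i)" for i
    using assms by (simp add: has_strict_derivative_def)
  show "bounded_linear (\<lambda>h. \<chi> i. D i (h $ i))"
    unfolding linear_conv_bounded_linear[symmetric]
    by (rule linearI) (simp_all only: vec_eq_iff vec_lambda_beta vector_add_component
          vector_scaleR_component linear_add[OF bounded_linear.linear[OF D]]
          linear_scale[OF bounded_linear.linear[OF D]] simp_thms)
  fix e :: real assume "e > 0"
  define N where "N = real CARD('n)"
  have "N > 0" by (simp add: N_def)
  have "\<forall>\<^sub>F z in nhds (x, x). \<forall>i\<in>UNIV. norm (f i (fst z $ i) - f i (snd z $ i) - D i (fst z $ i - snd z $ i))
      \<le> e / N * norm (fst z $ i - snd z $ i)"
  proof (intro eventually_ball_finite ballI finite)
    fix i
    have ev: "\<forall>\<^sub>F z in nhds (x $ i, x $ i).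
        norm (f i (fst z) - f i (snd z) - D i (fst z - snd z)) \<le> e / N * norm (fst z - snd z)"
      using assms[of i] by (rule has_strict_derivativeD) (use \<open>e > 0\<close> \<open>N > 0\<close> in simp)
    have "isCont (\<lambda>y. y $ i) x" by simp
    note lim = filterlim_Pair_isCont[OF this]
    from eventually_compose_filterlim[OF ev lim]
    show "\<forall>\<^sub>F z in nhds (x, x). norm (f i (fst z $ i) - f i (snd z $ i) - D i (fst z $ i - snd z $ i))
        \<le> e / N * norm (fst z $ i - snd z $ i)"
      by simp
  qed
  then show "\<forall>\<^sub>F z in nhds (x, x). norm ((\<chi> i. f i (fst z $ i)) - (\<chi> i. f i (snd z $ i)) -
      (\<chi> i. D i ((fst z - snd z) $ i))) \<le> e * norm (fst z - snd z)"
  proof eventually_elim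
    case (elim z)
    have "norm ((\<chi> i. f i (fst z $ i)) - (\<chi> i. f i (snd z $ i)) - (\<chi> i. D i ((fst z - snd z) $ i)))
        \<le> (\<Sum>i\<in>UNIV. norm (f i (fst z $ i) - f i (snd z $ i) - D i (fst z $ i - snd z $ i)))"
      unfolding norm_vec_def by (rule order_trans[OF L2_set_le_sum]) simp_all
    also have "\<dots> \<le> (\<Sum>i\<in>(UNIV::'n set). e / N * norm (fst z - snd z))"
    proof (rule sum_mono)
      fix i
      have "norm (fst z $ i - snd z $ i) \<le> norm (fst z - snd z)"
        using Finite_Cartesian_Product.norm_nth_le[of "fst z - snd z" i] by simp
      then show "norm (f i (fst z $ i) - f i (snd z $ i) - D i (fst z $ i - snd z $ i))
          \<le> e / N * norm (fst z - snd z)"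
        using elim \<open>e > 0\<close> \<open>N > 0\<close>
        by (intro order_trans[OF elim[rule_format] mult_left_mono]) simp_all
    qed
    also have "\<dots> = e * norm (fst z - snd z)"
      using \<open>N > 0\<close> by (simp add: N_def)
    finally show ?case .
  qed
qed

text \<open>
  The derivative of \<open>v / |v|\<close> depends continuously on \<open>v \<noteq> 0\<close>, so the mean value inequality makes it
  strict. With \<open>k = 1/|v|\<close> and \<open>m = 1/|v|\<^sup>3\<close> the derivative is \<open>h \<mapsto> k h - m (v \<bullet> h) v\<close>, and \<open>err v\<close> bounds
  the operator norm of its deviation from the derivative at \<open>p\<close>.
\<close>

lemma strict_derivative_sgn:
  fixes p :: "'a::real_inner"
  assumes "p \<noteq> 0"
  shows "\<exists>D. has_strict_derivative sgn D p"
proof -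
  define k where "k = (\<lambda>v::'a. inverse (norm v))"
  define m where "m = (\<lambda>v::'a. inverse (norm v ^ 3))"
  define D where "D = (\<lambda>v h :: 'a. k v *\<^sub>R h - (m v * (v \<bullet> h)) *\<^sub>R v)"
  have der: "(sgn has_derivative D v) (at v)" if "v \<noteq> 0" for v
  proof -
    have "((\<lambda>v. v /\<^sub>R norm v) has_derivative (\<lambda>h. inverse (norm v) *\<^sub>R h +
        (- (inverse (norm v) * (h \<bullet> sgn v) * inverse (norm v))) *\<^sub>R v)) (at v)"
      using that
      by (intro has_derivative_scaleR Deriv.has_derivative_inverse has_derivative_norm has_derivative_ident)
         (simp_all add: that)
    moreover have "inverse (norm v) * (h \<bullet> sgn v) * inverse (norm v) = m v * (v \<bullet> h)" for h
      by (simp add: m_def sgn_div_norm power3_eq_cube inner_commute[of h v])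
    ultimately have "((\<lambda>v. v /\<^sub>R norm v) has_derivative D v) (at v)" 
      by (simp add: D_def[abs_def] k_def)
    then show ?thesis by (simp add: sgn_div_norm[abs_def])
  qed
  have bl: "bounded_linear (D v)" if "v \<noteq> 0" for v
    using der[OF that] by (rule has_derivative_bounded_linear)
  define err where "err = (\<lambda>v. \<bar>k v - k p\<bar> + \<bar>m v\<bar> * norm v * norm (v - p)
      + \<bar>m v\<bar> * norm (v - p) * norm p + \<bar>m v - m p\<bar> * norm p * norm p)"
  have err: "norm (D v h - D p h) \<le> norm h * err v" for v h
  proof -
    have "D v h - D p h = (k v - k p) *\<^sub>R h - (m v * (v \<bullet> h)) *\<^sub>R (v - p)
       - (m v * ((v - p) \<bullet> h)) *\<^sub>R p - ((m v - m p) * (p \<bullet> h)) *\<^sub>R p"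
      by (simp add: D_def inner_diff_left scaleR_diff_left scaleR_diff_right left_diff_distrib right_diff_distrib)
    also have "norm \<dots> \<le> norm ((k v - k p) *\<^sub>R h) + norm ((m v * (v \<bullet> h)) *\<^sub>R (v - p))
       + norm ((m v * ((v - p) \<bullet> h)) *\<^sub>R p) + norm (((m v - m p) * (p \<bullet> h)) *\<^sub>R p)"
      by (intro order_trans[OF norm_triangle_ineq4] add_mono order_refl)
    also have "\<dots> \<le> \<bar>k v - k p\<bar> * norm h + \<bar>m v\<bar> * (norm v * norm h) * norm (v - p)
       + \<bar>m v\<bar> * (norm (v - p) * norm h) * norm p + \<bar>m v - m p\<bar> * (norm p * norm h) * norm p"
      by (intro add_mono)
         (simp_all add: abs_mult mult_right_mono mult_left_mono Cauchy_Schwarz_ineq2)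
    also have "\<dots> = norm h * err v"
      by (simp add: err_def algebra_simps)
    finally show ?thesis .
  qed
  have lim: "(err \<longlongrightarrow> 0) (nhds p)"
  proof -
    have "isCont err p" unfolding err_def k_def m_def using assms by (intro continuous_intros) auto
    moreover have "err p = 0" by (simp add: err_def)
    ultimately show ?thesis by (metis continuous_within tendsto_at_iff_tendsto_nhds)
  qed
  have "has_strict_derivative sgn (D p) p"
    unfolding has_strict_derivative_def
  proof (intro conjI allI impI bl assms)
    fix e :: real assume "e > 0"
    with lim have "\<forall>\<^sub>F v in nhds p. err v < e" by (rule order_tendstoD)
    moreover have "\<forall>\<^sub>F v in nhds p. v \<noteq> 0"
      using assms by (simp add: t1_space_nhds)
    ultimately have "\<forall>\<^sub>F v in nhds p. err v < e \<and> v \<noteq> 0" by (rule eventually_conj)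
    then obtain d where "d > 0" and d: "\<And>v. v \<in> ball p d \<Longrightarrow> err v < e \<and> v \<noteq> 0"
      
      unfolding eventually_nhds_metric by (metis dist_commute mem_ball)
    have "norm (sgn a - sgn b - D p (a - b)) \<le> e * norm (a - b)" if "a \<in> ball p d" "b \<in> ball p d" for a b
    proof -
      have "norm (sgn a - sgn b - D p (a - b)) \<le> norm (a - b) * e"
      proof (rule differentiable_bound_linearization[where S = "ball p d" and f' = D])
        show "b + t *\<^sub>R (a - b) \<in> ball p d" if "t \<in> {0..1}" for t
          using convexD_alt[OF convex_ball \<open>b \<in> ball p d\<close> \<open>a \<in> ball p d\<close>, of t] that
          by (simp add: algebra_simps)
        show "(sgn has_derivative D v) (at v within ball p d)" if "v \<in> ball p d" for v
          using der d[OF that] has_derivative_at_withinI by blast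
        show "onorm (D v - D p) \<le> e" if "v \<in> ball p d" for v
        proof (rule onorm_bound)
          show "norm ((D v - D p) h) \<le> e * norm h" for h
            using err[of v h] d[OF that] mult_left_mono[of "err v" e "norm h"]
            by (simp add: mult.commute fun_diff_def)
        qed (use \<open>e > 0\<close> in simp)
      qed (use \<open>d > 0\<close> in simp)
      then show ?thesis by (simp add: mult.commute)
    qed
    moreover have "\<forall>\<^sub>F v in nhds p. v \<in> ball p d"
      using \<open>d > 0\<close> by (intro eventually_nhds_in_open) auto
    ultimately show "\<forall>\<^sub>F z in nhds (p, p). norm (sgn (fst z) - sgn (snd z) - D p (fst z - snd z)) \<le> e * norm (fst z - snd z)"
      unfolding nhds_prod eventually_prod_same by (intro exI[of _ "\<lambda>v. v \<in> ball p d"]) auto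
  qed
  then show ?thesis by (intro exI[of _ "D p"])
qed

section \<open>Nearly Pythagorean projections\<close>

text \<open>
  For a projection \<open>P\<close> onto an affine subspace the theorem of Pythagoras gives
  \<open>|y - q|\<^sup>2 = |y - P y|\<^sup>2 + |P y - q|\<^sup>2\<close> for all points \<open>q\<close> of the subspace. For the curved sets of phase
  retrieval the identity survives up to an error that is small relative to \<open>|P y - q|\<^sup>2\<close> when \<open>y\<close> is near
  the base point, uniformly in \<open>q \<in> A\<close>. This one property replaces prox-regularity: it contains uniqueness
  of the nearest point, almost firm nonexpansiveness of \<open>P\<close>, and the fact that \<open>y - P y\<close> is normal to \<open>A\<close>
  up to second order.
\<close>

definition pythagorean_projection ::
  "('a::real_normed_vector \<Rightarrow> 'a) \<Rightarrow> 'a set \<Rightarrow> 'a \<Rightarrow> bool" where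
  "pythagorean_projection P A x \<longleftrightarrow> (\<exists>D. has_strict_derivative P D x) \<and>
     (\<forall>\<eta>>0. \<forall>\<^sub>F y in nhds x. P y \<in> A \<and>
        (\<forall>q\<in>A. \<bar>(norm (y - q))\<^sup>2 - (norm (y - P y))\<^sup>2 - (norm (P y - q))\<^sup>2\<bar> \<le> \<eta> * (norm (P y - q))\<^sup>2))"

lemma pythagorean_projectionD:
  assumes "pythagorean_projection P A x" and "\<eta> > 0"
  shows "\<forall>\<^sub>F y in nhds x. P y \<in> A \<and>
    (\<forall>q\<in>A. \<bar>(norm (y - q))\<^sup>2 - (norm (y - P y))\<^sup>2 - (norm (P y - q))\<^sup>2\<bar> \<le> \<eta> * (norm (P y - q))\<^sup>2)"
  using assms unfolding pythagorean_projection_def by blast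

lemma pythagorean_projection_fixes:
  assumes "pythagorean_projection P A x" and "x \<in> A"
  shows "P x = x"
proof -
  from eventually_nhds_x_imp_x[OF pythagorean_projectionD[OF assms(1) zero_less_one]]
  have "\<bar>(norm (x - x))\<^sup>2 - (norm (x - P x))\<^sup>2 - (norm (P x - x))\<^sup>2\<bar> \<le> 1 * (norm (P x - x))\<^sup>2"
    using assms(2) by blast
  then have "(norm (P x - x))\<^sup>2 \<le> 0"
    by (simp add: norm_minus_commute)
  then show ?thesis by simp
qed

lemma pythagorean_projection_filterlim:
  assumes "pythagorean_projection P A x" and "x \<in> A"
  shows "filterlim P (nhds x) (nhds x)"
proof -
  obtain D where "has_strict_derivative P D x"
    using assms(1) by (auto simp: pythagorean_projection_def)
  from strict_derivative_imp_isCont[OF this] pythagorean_projection_fixes[OF assms] show ?thesis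
    by (metis continuous_within tendsto_at_iff_tendsto_nhds)
qed

text \<open>
  A nearest point \<open>w\<close> satisfies \<open>|y - w| \<le> |y - P y|\<close>, which with an error of at most \<open>|P y - w|\<^sup>2 / 2\<close>
  forces \<open>|P y - w| = 0\<close>.
\<close>

lemma pythagorean_projection_unique:
  assumes "pythagorean_projection P A x"
  shows "\<forall>\<^sub>F y in nhds x. proj A y \<subseteq> {P y}"
proof -
  have "\<forall>\<^sub>F y in nhds x. P y \<in> A \<and>
      (\<forall>q\<in>A. \<bar>(norm (y - q))\<^sup>2 - (norm (y - P y))\<^sup>2 - (norm (P y - q))\<^sup>2\<bar> \<le> 1/2 * (norm (P y - q))\<^sup>2)"
    by (rule pythagorean_projectionD[OF assms]) simp
  then show ?thesis
  proof eventually_elim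
    case (elim y)
    then have "P y \<in> A" by simp
    have "w = P y" if "w \<in> proj A y" for w
    proof -
      have "w \<in> A" and w: "dist y w = infdist y A" using that by (auto simp: proj_def)
      have "norm (y - w) \<le> norm (y - P y)"
        using infdist_le[OF \<open>P y \<in> A\<close>, of y] w by (simp add: dist_norm)
      then have "(norm (y - w))\<^sup>2 \<le> (norm (y - P y))\<^sup>2" by (simp add: power_mono)
      moreover have "\<bar>(norm (y - w))\<^sup>2 - (norm (y - P y))\<^sup>2 - (norm (P y - w))\<^sup>2\<bar> \<le> 1/2 * (norm (P y - w))\<^sup>2"
        using elim \<open>w \<in> A\<close> by auto
      ultimately have "(norm (P y - w))\<^sup>2 \<le> 0" by linarith
      then show ?thesis by simp
    qed
    then show ?case by blast
  qed
qed

lemma pythagorean_projection_point: "pythagorean_projection (\<lambda>_. p) {p} x"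
  unfolding pythagorean_projection_def using strict_derivative_const by fastforce

text \<open>
  The points \<open>v\<close>, \<open>\<rho> sgn v\<close> and the origin are collinear, so the cross term in the expansion of
  \<open>|v - q|\<^sup>2\<close> is \<open>2 (|v| - \<rho>) (sgn v \<bullet> (\<rho> sgn v - q))\<close>, and for \<open>|q| = \<rho>\<close> the inner product is a multiple
  of \<open>|\<rho> sgn v - q|\<^sup>2\<close>. The curvature of the sphere thus enters only through the factor \<open>|v| / \<rho>\<close>, which
  tends to 1 at the sphere.
\<close>

lemma sphere_pythagoras:
  fixes v q :: "'a::real_inner"
  assumes "\<rho> > 0" "norm q = \<rho>" "v \<noteq> 0"
  shows "(norm (v - q))\<^sup>2 = (norm (v - \<rho> *\<^sub>R sgn v))\<^sup>2 + norm v / \<rho> * (norm (\<rho> *\<^sub>R sgn v - q))\<^sup>2"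
proof -
  define u where "u = sgn v"
  have u: "u \<bullet> u = 1" using assms(3) by (simp add: u_def norm_sgn dot_square_norm)
  have v: "v = norm v *\<^sub>R u" using assms(3) by (simp add: u_def sgn_div_norm)
  have q: "q \<bullet> q = \<rho>\<^sup>2" using assms(2) by (simp add: dot_square_norm)
  define t where "t = norm v"
  have "(norm (t *\<^sub>R u - q))\<^sup>2 = (norm (t *\<^sub>R u - \<rho> *\<^sub>R u))\<^sup>2 + t / \<rho> * (norm (\<rho> *\<^sub>R u - q))\<^sup>2"
    unfolding power2_norm_eq_inner using u q assms(1)
    by (simp add: inner_diff_left inner_diff_right inner_commute[of q u] field_simps power2_eq_square)
  then show ?thesis using v by (simp add: u_def t_def)
qed

text \<open>
  The radius 0 is included because prescribed Fourier magnitudes may vanish; the sphere is then a point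
  and \<open>0 *\<^sub>R sgn v\<close> is still its projection.
\<close>

lemma pythagorean_projection_sphere:
  fixes x :: "'a::real_inner"
  assumes "norm x = \<rho>"
  shows "pythagorean_projection (\<lambda>v. \<rho> *\<^sub>R sgn v) (sphere 0 \<rho>) x"
proof (cases "\<rho> = 0")
  case True
  then show ?thesis using pythagorean_projection_point[of 0 x] by simp
next
  case False
  with assms have "\<rho> > 0" "x \<noteq> 0" by auto
  show ?thesis
    unfolding pythagorean_projection_def
  proof (intro conjI allI impI)
    obtain D where "has_strict_derivative sgn D x"
      using strict_derivative_sgn[OF \<open>x \<noteq> 0\<close>] by blast
    from strict_derivative_compose[OF this strict_derivative_linear[OF bounded_linear_scaleR_right[of \<rho>]]]
    show "\<exists>D. has_strict_derivative (\<lambda>v. \<rho> *\<^sub>R sgn v) D x" by blast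
    fix \<eta> :: real assume "\<eta> > 0"
    have "((\<lambda>v. norm v / \<rho>) \<longlongrightarrow> norm x / \<rho>) (nhds x)"
      using \<open>\<rho> > 0\<close> by (intro tendsto_intros filterlim_ident) auto
    moreover have "norm x / \<rho> = 1" using assms \<open>\<rho> > 0\<close> by simp
    ultimately have "\<forall>\<^sub>F v in nhds x. dist (norm v / \<rho>) 1 < \<eta>"
      using \<open>\<eta> > 0\<close> by (simp add: tendsto_iff)
    moreover have "\<forall>\<^sub>F v in nhds x. v \<noteq> 0"
      using \<open>x \<noteq> 0\<close> by (simp add: t1_space_nhds)
    ultimately show "\<forall>\<^sub>F y in nhds x. \<rho> *\<^sub>R sgn y \<in> sphere 0 \<rho> \<and>
        (\<forall>q\<in>sphere 0 \<rho>. \<bar>(norm (y - q))\<^sup>2 - (norm (y - \<rho> *\<^sub>R sgn y))\<^sup>2 - (norm (\<rho> *\<^sub>R sgn y - q))\<^sup>2\<bar>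
           \<le> \<eta> * (norm (\<rho> *\<^sub>R sgn y - q))\<^sup>2)"
    proof eventually_elim
      case (elim v)
      have "\<bar>(norm (v - q))\<^sup>2 - (norm (v - \<rho> *\<^sub>R sgn v))\<^sup>2 - (norm (\<rho> *\<^sub>R sgn v - q))\<^sup>2\<bar>
           \<le> \<eta> * (norm (\<rho> *\<^sub>R sgn v - q))\<^sup>2" if "q \<in> sphere 0 \<rho>" for q
      proof -
        have "(norm (v - q))\<^sup>2 - (norm (v - \<rho> *\<^sub>R sgn v))\<^sup>2 - (norm (\<rho> *\<^sub>R sgn v - q))\<^sup>2
            = (norm v / \<rho> - 1) * (norm (\<rho> *\<^sub>R sgn v - q))\<^sup>2"
          using sphere_pythagoras[of \<rho> q v] that elim \<open>\<rho> > 0\<close> by (simp add: left_diff_distrib)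
        then show ?thesis
          using elim by (simp only: abs_mult) (auto simp: dist_real_def intro!: mult_right_mono)
      qed
      then show ?case using elim \<open>\<rho> > 0\<close> by (simp add: norm_sgn)
    qed
  qed
qed

lemma pythagorean_projection_vec:
  fixes x :: "'a::euclidean_space^'n::finite"
  assumes "\<And>i. pythagorean_projection (P i) (A i) (x $ i)"
  shows "pythagorean_projection (\<lambda>y. \<chi> i. P i (y $ i)) {y. \<forall>i. y $ i \<in> A i} x"
  unfolding pythagorean_projection_def
proof (intro conjI allI impI)
  have "\<forall>i. \<exists>D. has_strict_derivative (P i) D (x $ i)"
    using assms by (simp add: pythagorean_projection_def)
  then obtain D where "\<And>i. has_strict_derivative (P i) (D i) (x $ i)" by metis
  then show "\<exists>D. has_strict_derivative (\<lambda>y. \<chi> i. P i (y $ i)) D x"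
    using strict_derivative_vec by blast
  fix \<eta> :: real assume "\<eta> > 0"
  have "\<forall>\<^sub>F y in nhds x. \<forall>i\<in>UNIV. P i (y $ i) \<in> A i \<and>
    (\<forall>q\<in>A i. \<bar>(norm (y $ i - q))\<^sup>2 - (norm (y $ i - P i (y $ i)))\<^sup>2 - (norm (P i (y $ i) - q))\<^sup>2\<bar>
       \<le> \<eta> * (norm (P i (y $ i) - q))\<^sup>2)"
  proof (intro eventually_ball_finite ballI finite)
    fix i
    have "filterlim (\<lambda>y. y $ i) (nhds (x $ i)) (nhds x)" by (intro tendsto_intros filterlim_ident)
    with pythagorean_projectionD[OF assms \<open>\<eta> > 0\<close>, of i]
    show "\<forall>\<^sub>F y in nhds x. P i (y $ i) \<in> A i \<and>
      (\<forall>q\<in>A i. \<bar>(norm (y $ i - q))\<^sup>2 - (norm (y $ i - P i (y $ i)))\<^sup>2 - (norm (P i (y $ i) - q))\<^sup>2\<bar>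
         \<le> \<eta> * (norm (P i (y $ i) - q))\<^sup>2)"
      by (rule eventually_compose_filterlim)
  qed
  then show "\<forall>\<^sub>F y in nhds x. (\<chi> i. P i (y $ i)) \<in> {y. \<forall>i. y $ i \<in> A i} \<and>
    (\<forall>q\<in>{y. \<forall>i. y $ i \<in> A i}. \<bar>(norm (y - q))\<^sup>2 - (norm (y - (\<chi> i. P i (y $ i))))\<^sup>2
       - (norm ((\<chi> i. P i (y $ i)) - q))\<^sup>2\<bar> \<le> \<eta> * (norm ((\<chi> i. P i (y $ i)) - q))\<^sup>2)"
  proof eventually_elim
    case (elim y)
    have sq: "(norm z)\<^sup>2 = (\<Sum>i\<in>UNIV. (norm (z $ i))\<^sup>2)" for z :: "'a^'n"
      by (simp add: norm_vec_def L2_set_def sum_nonneg)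
    have "\<bar>(norm (y - q))\<^sup>2 - (norm (y - (\<chi> i. P i (y $ i))))\<^sup>2 - (norm ((\<chi> i. P i (y $ i)) - q))\<^sup>2\<bar>
        \<le> \<eta> * (norm ((\<chi> i. P i (y $ i)) - q))\<^sup>2" if q: "\<forall>i. q $ i \<in> A i" for q
      unfolding sq sum_subtractf[symmetric] sum_distrib_left
      by (rule order_trans[OF sum_abs sum_mono]) (use elim q in simp)
    with elim show ?case by simp
  qed
qed

text \<open>
  A map that scales all distances by \<open>c\<close> scales the whole Pythagorean identity by \<open>c\<^sup>2\<close>.
\<close>

lemma pythagorean_projection_vimage:
  fixes U :: "'a::euclidean_space \<Rightarrow> 'b::euclidean_space"
  assumes U: "linear U" "surj U" and "c > 0" and norm_U: "\<And>z. norm (U z) = c * norm z"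
    and P: "pythagorean_projection P A (U x)"
  shows "pythagorean_projection (\<lambda>y. inv U (P (U y))) (U -` A) x"
  unfolding pythagorean_projection_def
proof (intro conjI allI impI)
  have "inj U"
    using norm_U \<open>c > 0\<close> by (simp add: linear_injective_0[OF U(1)]) (metis mult_eq_0_iff norm_eq_zero order_less_irrefl)
  have U_inv: "U (inv U z) = z" for z using U(2) by (simp add: surj_f_inv_f)
  have linv: "linear (inv U)"
    by (rule linearI; rule injD[OF \<open>inj U\<close>])
       (simp_all add: U_inv linear_add[OF U(1)] linear_scale[OF U(1)])
  have bl: "bounded_linear U" "bounded_linear (inv U)"
    using U(1) linv by (simp_all add: linear_conv_bounded_linear)
  from P obtain D where D: "has_strict_derivative P D (U x)"
    by (auto simp: pythagorean_projection_def)
  from strict_derivative_compose[OF strict_derivative_compose[OF strict_derivative_linear[OF bl(1)] D] strict_derivative_linear[OF bl(2)]]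
  show "\<exists>D. has_strict_derivative (\<lambda>y. inv U (P (U y))) D x" by blast
  fix \<eta> :: real assume "\<eta> > 0"
  have "isCont U x" using bl(1) by (simp add: linear_continuous_at)
  then have "filterlim U (nhds (U x)) (nhds x)"
    by (simp add: continuous_within tendsto_at_iff_tendsto_nhds)
  from eventually_compose_filterlim[OF pythagorean_projectionD[OF P \<open>\<eta> > 0\<close>] this]
  show "\<forall>\<^sub>F y in nhds x. inv U (P (U y)) \<in> U -` A \<and>
    (\<forall>q\<in>U -` A. \<bar>(norm (y - q))\<^sup>2 - (norm (y - inv U (P (U y))))\<^sup>2 - (norm (inv U (P (U y)) - q))\<^sup>2\<bar>
       \<le> \<eta> * (norm (inv U (P (U y)) - q))\<^sup>2)"
  proof eventually_elim
    case (elim y)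
    have sq: "(norm (a - b))\<^sup>2 = (norm (U a - U b))\<^sup>2 / c\<^sup>2" for a b
      using \<open>c > 0\<close> norm_U[of "a - b"] by (simp add: linear_diff[OF U(1)] power_mult_distrib)
    have "\<bar>(norm (y - q))\<^sup>2 - (norm (y - inv U (P (U y))))\<^sup>2 - (norm (inv U (P (U y)) - q))\<^sup>2\<bar>
       \<le> \<eta> * (norm (inv U (P (U y)) - q))\<^sup>2" if "U q \<in> A" for q
      unfolding sq U_inv diff_divide_distrib[symmetric]
      using elim that by (simp add: divide_right_mono)
    with elim show ?case by (simp add: U_inv)
  qed
qed

lemma pythagorean_projection_matrix:
  fixes x :: "'a::euclidean_space^'n^'m"
  assumes "\<And>p q. pythagorean_projection (P p q) (A p q) (x $ p $ q)"
  shows "pythagorean_projection (\<lambda>y. \<chi> p q. P p q (y $ p $ q)) {y. \<forall>p q. y $ p $ q \<in> A p q} x"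
proof -
  have "pythagorean_projection (\<lambda>v. \<chi> q. P p q (v $ q)) {v. \<forall>q. v $ q \<in> A p q} (x $ p)" for p
    by (rule pythagorean_projection_vec) (rule assms)
  then have "pythagorean_projection (\<lambda>y. \<chi> p. (\<lambda>v. \<chi> q. P p q (v $ q)) (y $ p))
      {y. \<forall>p. y $ p \<in> {v. \<forall>q. v $ q \<in> A p q}} x"
    by (rule pythagorean_projection_vec)
  then show ?thesis by simp
qed

section \<open>Local linear convergence of alternating projections\<close>

lemma le_infdist:
  assumes "S \<noteq> {}" and "\<And>p. p \<in> S \<Longrightarrow> r \<le> dist y p"
  shows "r \<le> infdist y S"
  unfolding infdist_notempty[OF assms(1)] using assms by (intro cINF_greatest) auto

lemma infdist_lessE:
  assumes "S \<noteq> {}" and "infdist y S < r"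
  obtains p where "p \<in> S" and "dist y p < r"
  using le_infdist[OF assms(1), of r y] assms(2) by force

text \<open>
  Points of \<open>S\<close> outside the ball are farther from \<open>y\<close> than \<open>x\<close> itself is.
\<close>

lemma infdist_inter_ball_le:
  assumes "x \<in> S" and "y \<in> ball x (r / 2)"
  shows "infdist y (S \<inter> ball x r) \<le> infdist y S"
proof (rule le_infdist)
  have "dist x y < r / 2" and "r > 0" using assms(2) by auto (smt (verit) zero_le_dist)
  fix p assume "p \<in> S"
  show "infdist y (S \<inter> ball x r) \<le> dist y p"
  proof (cases "p \<in> ball x r")
    case True
    then show ?thesis using \<open>p \<in> S\<close> by (intro infdist_le) auto
  next
    case False
    have "infdist y (S \<inter> ball x r) \<le> dist y x"
      using assms(1) \<open>r > 0\<close> by (intro infdist_le) auto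
    also have "\<dots> \<le> dist y p"
      using False \<open>dist x y < r / 2\<close> dist_triangle[of x p y] by (simp add: dist_commute)
    finally show ?thesis .
  qed
qed (use assms in blast)

text \<open>
  The distances to \<open>S\<close> decay like \<open>q^k\<close>, hence so do the steps, and the steps sum to at most a fixed multiple
  of the initial distance. A small enough initial ball therefore keeps all iterates where the two
  estimates hold, and the geometric tails give the rate.
\<close>

lemma contracting_distance_imp_linear_convergence:
  fixes T :: "'a::banach \<Rightarrow> 'a set"
  assumes "xs \<in> S" and "\<rho> > 0" and "0 \<le> q" "q < 1" and "K \<ge> 0"
    and contract: "\<And>y w. y \<in> ball xs \<rho> \<Longrightarrow> w \<in> T y \<Longrightarrow> infdist w S \<le> q * infdist y S"
    and step: "\<And>y w. y \<in> ball xs \<rho> \<Longrightarrow> w \<in> T y \<Longrightarrow> dist y w \<le> K * infdist y S"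
  shows "\<exists>\<epsilon>>0. \<forall>x :: nat \<Rightarrow> 'a. x 0 \<in> ball xs \<epsilon> \<and> (\<forall>k. x (Suc k) \<in> T (x k)) \<longrightarrow>
    (\<exists>xb \<in> closure S. R_linearly_converges x xb)"
proof -
  \<comment> \<open>The iterates stay within \<open>B * dist (x 0) xs\<close> of \<open>xs\<close>.\<close>
  define B where "B = 1 + K / (1 - q)"
  have "B \<ge> 1" using assms(3-5) by (simp add: B_def)
  have "\<exists>xb \<in> closure S. R_linearly_converges x xb"
    if x0: "x 0 \<in> ball xs (\<rho> / B)" and xT: "\<And>k. x (Suc k) \<in> T (x k)" for x :: "nat \<Rightarrow> 'a"
  proof -
    define d where "d = infdist (x 0) S"
    define \<gamma> where "\<gamma> = K * d / (1 - q)"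
    have "d \<ge> 0" by (simp add: d_def infdist_nonneg)
    have "\<gamma> \<ge> 0" using \<open>d \<ge> 0\<close> assms by (simp add: \<gamma>_def)
    have \<gamma>: "\<gamma> * (1 - q) = K * d" using \<open>q < 1\<close> by (simp add: \<gamma>_def)
    have d: "d \<le> dist (x 0) xs" using \<open>xs \<in> S\<close> by (simp add: d_def infdist_le)
    have "dist (x 0) xs + \<gamma> \<le> dist (x 0) xs * B"
      using d assms by (simp add: B_def \<gamma>_def algebra_simps mult_left_mono divide_right_mono)
    also have "\<dots> < \<rho>"
      using x0 \<open>B \<ge> 1\<close> by (simp add: dist_commute pos_less_divide_eq)
    finally have room: "dist (x 0) xs + \<gamma> < \<rho>" .
    have inv: "infdist (x k) S \<le> q ^ k * d \<and> dist (x 0) (x k) \<le> \<gamma> * (1 - q ^ k) \<and> x k \<in> ball xs \<rho>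
        \<and> dist (x k) (x (Suc k)) \<le> \<gamma> * (1 - q) * q ^ k" for k
    proof (induction k)
      case 0
      have "x 0 \<in> ball xs \<rho>" using room \<open>\<gamma> \<ge> 0\<close> by (simp add: dist_commute)
      moreover have "dist (x 0) (x (Suc 0)) \<le> K * d"
        using step[OF calculation xT] by (simp add: d_def)
      ultimately show ?case by (simp add: d_def \<gamma>)
    next
      case (Suc k)
      then have IH: "infdist (x k) S \<le> q ^ k * d" "dist (x 0) (x k) \<le> \<gamma> * (1 - q ^ k)"
        "x k \<in> ball xs \<rho>" "dist (x k) (x (Suc k)) \<le> \<gamma> * (1 - q) * q ^ k" by auto
      have "infdist (x (Suc k)) S \<le> q * (q ^ k * d)"
        using contract[OF IH(3) xT] mult_left_mono[OF IH(1) \<open>0 \<le> q\<close>] by linarith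
      then have 1: "infdist (x (Suc k)) S \<le> q ^ Suc k * d" by (simp add: mult_ac)
      have 2: "dist (x 0) (x (Suc k)) \<le> \<gamma> * (1 - q ^ Suc k)"
        using dist_triangle[of "x 0" "x (Suc k)" "x k"] IH(2,4) by (simp add: algebra_simps)
      have "\<gamma> * (1 - q ^ Suc k) \<le> \<gamma>"
        using \<open>\<gamma> \<ge> 0\<close> \<open>0 \<le> q\<close> by (simp add: algebra_simps)
      then have 3: "x (Suc k) \<in> ball xs \<rho>"
        using 2 room dist_triangle[of xs "x (Suc k)" "x 0"] by (simp add: dist_commute)
      have "dist (x (Suc k)) (x (Suc (Suc k))) \<le> K * (q ^ Suc k * d)"
        using step[OF 3 xT] mult_left_mono[OF 1 \<open>K \<ge> 0\<close>] by linarith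
      also have "\<dots> = \<gamma> * (1 - q) * q ^ Suc k" by (simp add: \<gamma>)
      finally show ?case using 1 2 3 by blast
    qed
    have tail: "dist (x k) (x (k + m)) \<le> \<gamma> * q ^ k * (1 - q ^ m)" for k m
    proof (induction m)
      case (Suc m)
      then show ?case
        using dist_triangle[of "x k" "x (k + Suc m)" "x (k + m)"] inv[of "k + m"]
        by (simp add: algebra_simps power_add)
    qed simp
    have "\<gamma> * q ^ k * (1 - q ^ m) \<le> \<gamma> * q ^ k" for k m
      using \<open>\<gamma> \<ge> 0\<close> \<open>0 \<le> q\<close> by (simp add: algebra_simps)
    with tail have tail': "dist (x k) (x (k + m)) \<le> \<gamma> * q ^ k" for k m
      using order_trans by blast
    have q0: "(\<lambda>k. \<gamma> * q ^ k) \<longlonglongrightarrow> \<gamma> * 0" "(\<lambda>k. q ^ k * d) \<longlonglongrightarrow> 0 * d"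
      using assms by (intro tendsto_intros LIMSEQ_realpow_zero; simp)+
    have "Cauchy x"
    proof (rule metric_CauchyI)
      fix e :: real assume "e > 0"
      have "\<forall>\<^sub>F k in sequentially. \<gamma> * q ^ k < e / 2"
        using q0(1) \<open>e > 0\<close> by (intro order_tendstoD[of _ "\<gamma> * 0"]) auto
      then obtain N where N: "\<gamma> * q ^ N < e / 2" by (auto simp: eventually_sequentially)
      have "dist (x m) (x n) < e" if "m \<ge> N" "n \<ge> N" for m n
        using tail'[of N "m - N"] tail'[of N "n - N"] that N dist_triangle3[of "x m" "x n" "x N"] by simp
      then show "\<exists>M. \<forall>m\<ge>M. \<forall>n\<ge>M. dist (x m) (x n) < e" by blast
    qed
    then obtain xb where xb: "x \<longlonglongrightarrow> xb" using Cauchy_convergent_iff convergent_def by blast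
    have rate: "dist (x k) xb \<le> \<gamma> * q ^ k" for k
    proof (rule Lim_bounded)
      show "(\<lambda>m. dist (x k) (x m)) \<longlonglongrightarrow> dist (x k) xb" by (intro tendsto_intros xb)
      show "\<forall>m\<ge>k. dist (x k) (x m) \<le> \<gamma> * q ^ k" using tail' by (metis le_add_diff_inverse)
    qed
    have "infdist xb S \<le> 0 * d"
    proof (rule tendsto_le[OF _ q0(2)])
      show "(\<lambda>k. infdist (x k) S) \<longlonglongrightarrow> infdist xb S" by (intro tendsto_infdist xb)
    qed (use inv in auto)
    then have "xb \<in> closure S"
      using \<open>xs \<in> S\<close> by (subst in_closure_iff_infdist_zero) (auto simp: infdist_nonneg antisym)
    moreover have "R_linearly_converges x xb"
      unfolding R_linearly_converges_def
    proof (intro bexI exI conjI allI)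
      show "norm (x k - xb) \<le> (\<gamma> + 1) * q ^ k" for k
        using rate[of k] zero_le_power[OF \<open>0 \<le> q\<close>, of k] by (simp add: dist_norm distrib_right)
    qed (use \<open>\<gamma> \<ge> 0\<close> assms in auto)
    ultimately show ?thesis by blast
  qed
  moreover have "\<rho> / B > 0" using \<open>\<rho> > 0\<close> \<open>B \<ge> 1\<close> by simp
  ultimately show ?thesis by blast
qed

text \<open>
  Inserting an almost midpoint replaces one gap of length \<open>l\<close> by two gaps of length at most \<open>5/8 l\<close>. The
  quadratic bound for the variation of \<open>g\<close> thereby shrinks by the factor \<open>2 (5/8)\<^sup>2 = 25/32 < 1\<close>, so
  repeated insertion shows that \<open>g\<close> does not vary at all. The condition on \<open>dist x a + 2 * dist a b\<close> is
  inherited by both new pairs and keeps them in the ball.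
\<close>

lemma constant_if_quadratic_and_almost_midpoint_convex:
  fixes g :: "'a::real_normed_vector \<Rightarrow> real"
  assumes "L \<ge> 0" and quad: "\<And>a b. a \<in> S \<inter> ball x \<rho> \<Longrightarrow> b \<in> S \<inter> ball x \<rho> \<Longrightarrow> \<bar>g a - g b\<bar> \<le> L * (dist a b)\<^sup>2"
    and mid: "\<And>a b. a \<in> S \<inter> ball x \<rho> \<Longrightarrow> b \<in> S \<inter> ball x \<rho> \<Longrightarrow>
      \<exists>m\<in>S. dist (midpoint a b) m \<le> dist a b / 8"
    and "a \<in> S" "b \<in> S" and "dist x a + 2 * dist a b < \<rho>"
  shows "g a = g b"
proof -
  have bound: "\<bar>g a - g b\<bar> \<le> L * (dist a b)\<^sup>2 * (25/32) ^ n"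
    if "a \<in> S" "b \<in> S" "dist x a + 2 * dist a b < \<rho>" for a b n
    using that
  proof (induction n arbitrary: a b)
    case 0
    have "dist x b < \<rho>" "dist x a < \<rho>"
      using 0(3) dist_triangle[of x b a] zero_le_dist[of a b] by linarith+
    then show ?case using 0 quad[of a b] by simp
  next
    case (Suc n)
    define l where "l = dist a b"
    have "l \<ge> 0" by (simp add: l_def)
    have "dist x a < \<rho>" "dist x b < \<rho>"
      using Suc.prems(3) dist_triangle[of x b a] zero_le_dist[of a b] by linarith+
    then obtain m where "m \<in> S" and m: "dist (midpoint a b) m \<le> l / 8"
      using mid[of a b] Suc.prems by (auto simp: l_def)
    have am: "dist a m \<le> 5/8 * l" and mb: "dist m b \<le> 5/8 * l"
      using m dist_triangle[of a m "midpoint a b"] dist_triangle[of m b "midpoint a b"]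
      by (simp_all add: dist_midpoint dist_commute l_def)
    have half: "L * (dist u v)\<^sup>2 * (25/32) ^ n \<le> L * (5/8 * l)\<^sup>2 * (25/32) ^ n"
      if "dist u v \<le> 5/8 * l" for u v :: 'a
      using that \<open>L \<ge> 0\<close> by (intro mult_right_mono mult_left_mono power_mono) auto
    have "\<bar>g a - g m\<bar> \<le> L * (5/8 * l)\<^sup>2 * (25/32) ^ n"
      using am Suc.prems(1,3) \<open>m \<in> S\<close> \<open>l \<ge> 0\<close> unfolding l_def
      by (intro order_trans[OF Suc.IH half[unfolded l_def]]) linarith+
    moreover have "\<bar>g m - g b\<bar> \<le> L * (5/8 * l)\<^sup>2 * (25/32) ^ n"
      using am mb Suc.prems(2,3) \<open>m \<in> S\<close> \<open>l \<ge> 0\<close> dist_triangle[of x m a] unfolding l_def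
      by (intro order_trans[OF Suc.IH half[unfolded l_def]]) linarith+
    ultimately have "\<bar>g a - g b\<bar> \<le> 2 * (L * (5/8 * l)\<^sup>2 * (25/32) ^ n)" by linarith
    also have "\<dots> = L * (dist a b)\<^sup>2 * (25/32) ^ Suc n"
      by (simp add: l_def power2_eq_square)
    finally show ?case .
  qed
  have "(\<lambda>n. L * (dist a b)\<^sup>2 * (25/32 :: real) ^ n) \<longlonglongrightarrow> L * (dist a b)\<^sup>2 * 0"
    by (intro tendsto_intros LIMSEQ_realpow_zero) auto
  then have "\<bar>g a - g b\<bar> \<le> L * (dist a b)\<^sup>2 * 0"
    by (rule LIMSEQ_le_const) (use bound assms in blast)
  then show ?thesis by simp
qed

text \<open>
  In this form, finitely many local properties can be conjoined and a common radius extracted.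
\<close>

lemma eventually_nhds_pair_ball:
  assumes "\<forall>\<^sub>F z in nhds (x, x). R (fst z) (snd z)"
  shows "\<forall>\<^sub>F r in at_right 0. \<forall>a\<in>ball x r. \<forall>b\<in>ball x r. R a b"
proof -
  obtain Q where "eventually Q (nhds x)" and Q: "\<And>a b. Q a \<Longrightarrow> Q b \<Longrightarrow> R a b"
    using assms unfolding nhds_prod eventually_prod_same by auto
  then obtain d where "d > 0" and d: "\<And>y. dist y x < d \<Longrightarrow> Q y"
    by (auto simp: eventually_nhds_metric)
  have "R a b" if "r < d" "a \<in> ball x r" "b \<in> ball x r" for a b r
    using that by (intro Q d) (auto simp: dist_commute)
  then show ?thesis using \<open>d > 0\<close> by (auto simp: eventually_at_right)
qed

lemma eventually_nhds_ball:
  fixes x :: "'a::metric_space"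
  assumes "eventually R (nhds x)"
  shows "\<forall>\<^sub>F r in at_right 0. \<forall>y\<in>ball x r. R y"
proof -
  obtain d where "d > 0" and d: "\<And>y. dist y x < d \<Longrightarrow> R y"
    using assms by (auto simp: eventually_nhds_metric)
  then have "R y" if "r < d" "y \<in> ball x r" for r y
    using that by (intro d) (auto simp: dist_commute)
  then show ?thesis using \<open>d > 0\<close> by (auto simp: eventually_at_right)
qed

text \<open>
  Three steps: near \<open>x\<close> the set \<open>S\<close> of fixed points is contained in \<open>A \<inter> C\<close>; the map \<open>G = Q \<circ> P\<close> contracts the
  distance to \<open>S\<close>; contraction gives R-linear convergence.

  The first step is the delicate one, since a fixed point of alternating projections may be one end of a
  shortest segment between \<open>A\<close> and \<open>C\<close>. The squared distance \<open>g\<close> to \<open>A\<close> has to be shown to vanish on \<open>S\<close>.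
  At fixed points the residual \<open>a - P a\<close> is normal to \<open>C\<close>, so \<open>g\<close> varies at most quadratically on \<open>S\<close>.
  Strict differentiability of \<open>G\<close> makes the midpoint of two fixed points an almost fixed point, and
  metric subregularity turns an almost fixed point into a nearby fixed point. Hence \<open>S\<close> is almost midpoint
  convex, so \<open>g\<close> is constant on \<open>S\<close> near \<open>x\<close>, and \<open>g x = 0\<close>.

  In the second step, the two Pythagorean identities bound the decrease of the squared distance to a point
  of \<open>S\<close> from below by half the squared step \<open>|y - G y|\<^sup>2\<close>, up to a factor close to 1, and subregularity
  bounds the step below by \<open>\<kappa>\<close> times the distance to \<open>S\<close>.
\<close>

theorem alternating_projections_linear_convergence:
  fixes T :: "'a::banach \<Rightarrow> 'a set"
  assumes "closed A" "closed C" and "x \<in> A" "x \<in> C"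
    and P: "pythagorean_projection P A x" and Q: "pythagorean_projection Q C x"
    and T: "\<forall>\<^sub>F y in nhds x. T y \<subseteq> {Q (P y)}" and "x \<in> T x"
    and sub: "metrically_subregular (id_minus T) x 0"
  shows "\<exists>\<epsilon>>0. \<forall>z :: nat \<Rightarrow> 'a. z 0 \<in> ball x \<epsilon> \<and> (\<forall>k. z (Suc k) \<in> T (z k)) \<longrightarrow>
    (\<exists>xb \<in> A \<inter> C. R_linearly_converges z xb)"
proof -
  define S where "S = {u. u \<in> T u}"
  have S_eq: "{u. 0 \<in> id_minus T u} = S" by (auto simp: S_def id_minus_def)
  define G where "G = (\<lambda>y. Q (P y))"
  have G_eq: "Q (P y) = G y" for y by (simp add: G_def)
  obtain \<kappa> \<delta> where "\<kappa> > 0" "\<delta> > 0"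
    and \<kappa>: "\<And>y. y \<in> ball x \<delta> \<Longrightarrow> \<kappa> * infdist y S \<le> infdist 0 (id_minus T y)"
    using sub unfolding metrically_subregular_def S_eq by blast
  \<comment> \<open>The gain in the contraction estimate is of order \<open>k / 2\<close>, the loss from curvature of order \<open>2 * \<eta>\<close>;
    \<open>\<eta> = k / 8\<close> makes the gain win.\<close>
  define k where "k = (min \<kappa> 1)\<^sup>2"
  have k: "0 < k" "k \<le> 1" using \<open>\<kappa> > 0\<close> by (auto simp: k_def power_le_one)
  define \<eta> where "\<eta> = k / 8"
  have \<eta>: "0 < \<eta>" "\<eta> \<le> 1 / 8" using k by (simp_all add: \<eta>_def)
  have "P x = x" using P \<open>x \<in> A\<close> by (rule pythagorean_projection_fixes)
  obtain DP DQ where DP: "has_strict_derivative P DP x" and DQ: "has_strict_derivative Q DQ x"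
    using P Q by (auto simp: pythagorean_projection_def)
  obtain D where D: "has_strict_derivative G D x"
    using strict_derivative_compose[OF DP] DQ \<open>P x = x\<close> by (auto simp: G_def)
  have "linear D" using D by (simp add: has_strict_derivative_def bounded_linear.linear)
  obtain M where "M > 0"
    and M: "\<forall>\<^sub>F z in nhds (x, x). norm (G (fst z) - G (snd z)) \<le> M * norm (fst z - snd z)"
    using strict_derivative_imp_Lipschitz[OF D] .
  note Q' = eventually_compose_filterlim[OF pythagorean_projectionD[OF Q \<eta>(1)]
      pythagorean_projection_filterlim[OF P \<open>x \<in> A\<close>]]
  have "\<kappa> / 8 > 0" using \<open>\<kappa> > 0\<close> by simp
  have "\<forall>\<^sub>F y in nhds x. y \<in> ball x \<delta>" using \<open>\<delta> > 0\<close> by (intro eventually_nhds_in_open) auto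
  have "\<forall>\<^sub>F r in at_right (0::real). r > 0" by (simp add: eventually_at_right_less)
  from eventually_happens'[OF trivial_limit_at_right_real eventually_conj[OF this
      eventually_conj[OF eventually_nhds_ball[OF pythagorean_projectionD[OF P \<eta>(1)]]
      eventually_conj[OF eventually_nhds_ball[OF Q']
      eventually_conj[OF eventually_nhds_ball[OF \<open>\<forall>\<^sub>F y in nhds x. y \<in> ball x \<delta>\<close>]
      eventually_conj[OF eventually_nhds_ball[OF T]
      eventually_conj[OF eventually_nhds_pair_ball[OF M]
        eventually_nhds_pair_ball[OF has_strict_derivativeD[OF D \<open>\<kappa> / 8 > 0\<close>]]]]]]]]]
  obtain \<rho> where "\<rho> > 0"
    and PA: "\<And>y. y \<in> ball x \<rho> \<Longrightarrow> P y \<in> A"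
    and pythP: "\<And>y q. y \<in> ball x \<rho> \<Longrightarrow> q \<in> A \<Longrightarrow>
      \<bar>(norm (y - q))\<^sup>2 - (norm (y - P y))\<^sup>2 - (norm (P y - q))\<^sup>2\<bar> \<le> \<eta> * (norm (P y - q))\<^sup>2"
    and GC: "\<And>y. y \<in> ball x \<rho> \<Longrightarrow> G y \<in> C"
    and pythQ: "\<And>y q. y \<in> ball x \<rho> \<Longrightarrow> q \<in> C \<Longrightarrow>
      \<bar>(norm (P y - q))\<^sup>2 - (norm (P y - G y))\<^sup>2 - (norm (G y - q))\<^sup>2\<bar> \<le> \<eta> * (norm (G y - q))\<^sup>2"
    and \<rho>\<delta>: "\<And>y. y \<in> ball x \<rho> \<Longrightarrow> y \<in> ball x \<delta>"
    and TG: "\<And>y w. y \<in> ball x \<rho> \<Longrightarrow> w \<in> T y \<Longrightarrow> w = G y"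
    and Lip: "\<And>a b. a \<in> ball x \<rho> \<Longrightarrow> b \<in> ball x \<rho> \<Longrightarrow> norm (G a - G b) \<le> M * norm (a - b)"
    and strict: "\<And>a b. a \<in> ball x \<rho> \<Longrightarrow> b \<in> ball x \<rho> \<Longrightarrow>
      norm (G a - G b - D (a - b)) \<le> \<kappa> / 8 * norm (a - b)"
    unfolding G_eq by (elim exE conjE) (rule that, assumption, blast+)
  have subreg: "\<kappa> * infdist y S \<le> norm (y - G y)" if "y \<in> ball x \<rho>" for y
  proof -
    have "infdist 0 (id_minus T y) \<le> norm (y - G y)"
    \<comment> \<open>If \<open>T y\<close> is empty, \<open>infdist\<close> takes the default value 0.\<close>
    proof (cases "T y = {}")
      case True
      then show ?thesis by (simp add: id_minus_def infdist_def)
    next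
      case False
      then have "y - G y \<in> id_minus T y" using TG[OF that] by (auto simp: id_minus_def)
      from infdist_le[OF this, of 0] show ?thesis by simp
    qed
    with \<kappa>[OF \<rho>\<delta>[OF that]] show ?thesis by linarith
  qed
  have "x \<in> S" using \<open>x \<in> T x\<close> by (simp add: S_def)
  have fixed: "G a = a" "a \<in> C" if "a \<in> S" "a \<in> ball x \<rho>" for a
    using TG[OF that(2)] GC[OF that(2)] that(1) by (auto simp: S_def)

  define g where "g = (\<lambda>a. (norm (a - P a))\<^sup>2)"
  have g_le: "g b \<le> g a + 2 * (dist a b)\<^sup>2" if "a \<in> S \<inter> ball x \<rho>" "b \<in> S \<inter> ball x \<rho>" for a b
  proof -
    \<comment> \<open>\<open>b\<close> is compared with \<open>P a \<in> A\<close>; as \<open>a = Q (P a)\<close> and \<open>b \<in> C\<close>, the cross term is of second order.\<close>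
    have "(norm (P a - b))\<^sup>2 \<le> g a + (norm (a - b))\<^sup>2 + \<eta> * (norm (a - b))\<^sup>2"
      using pythQ[of a b] fixed[of a] fixed[of b] that by (auto simp: g_def norm_minus_commute)
    moreover have "g b + (norm (P b - P a))\<^sup>2 - \<eta> * (norm (P b - P a))\<^sup>2 \<le> (norm (P a - b))\<^sup>2"
      using pythP[of b "P a"] PA[of a] that by (auto simp: g_def norm_minus_commute)
    moreover have "\<eta> * (norm (P b - P a))\<^sup>2 \<le> (norm (P b - P a))\<^sup>2" "\<eta> * (norm (a - b))\<^sup>2 \<le> (norm (a - b))\<^sup>2"
      using \<eta> by (auto intro!: mult_left_le_one_le)
    ultimately show ?thesis by (simp add: dist_norm)
  qed
  have almost_midpoint: "\<exists>m\<in>S. dist (midpoint a b) m \<le> dist a b / 8"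
    if "a \<in> S \<inter> ball x \<rho>" "b \<in> S \<inter> ball x \<rho>" for a b
  proof (cases "a = b")
    case True
    then show ?thesis using that by auto
  next
    case False
    define m where "m = midpoint a b"
    have "m \<in> ball x \<rho>"
      using that closed_segment_subset[OF _ _ convex_ball, of a x \<rho> b] midpoint_in_closed_segment
      unfolding m_def by blast
    have "a - m = (1/2) *\<^sub>R (a - b)" "b - m = - ((1/2) *\<^sub>R (a - b))"
      by (simp_all add: m_def midpoint_def algebra_simps) (simp_all flip: scaleR_add_left)
    then have nm: "norm (a - m) = norm (a - b) / 2" "norm (b - m) = norm (a - b) / 2"
      and Dm: "D (a - m) + D (b - m) = 0"
      by (simp_all add: linear_neg[OF \<open>linear D\<close>])
    \<comment> \<open>The first-order terms cancel, as \<open>a - m\<close> and \<open>b - m\<close> are opposite.\<close>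
    have "2 *\<^sub>R (m - G m) = (G a - G m - D (a - m)) + (G b - G m - D (b - m))"
      using fixed[of a] fixed[of b] that Dm
      by (simp add: m_def midpoint_def algebra_simps scaleR_2 eq_neg_iff_add_eq_0)
    then have "2 * norm (m - G m) \<le> norm (G a - G m - D (a - m)) + norm (G b - G m - D (b - m))"
      by (metis norm_scaleR abs_numeral norm_triangle_ineq)
    also have "\<dots> \<le> \<kappa> / 8 * norm (a - m) + \<kappa> / 8 * norm (b - m)"
      using that \<open>m \<in> ball x \<rho>\<close> by (intro add_mono strict) auto
    finally have "\<kappa> * infdist m S \<le> \<kappa> * (dist a b / 16)"
      using subreg[OF \<open>m \<in> ball x \<rho>\<close>] by (simp add: nm dist_norm)
    then have "infdist m S < dist a b / 8"
      using \<open>\<kappa> > 0\<close> False by (simp add: pos_less_divide_eq) (smt (verit) zero_less_dist_iff)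
    then obtain u where "u \<in> S" "dist m u < dist a b / 8"
      using infdist_lessE[of S m] \<open>x \<in> S\<close> by blast
    then show ?thesis unfolding m_def by (intro bexI[of _ u]) simp_all
  qed
  have in_A: "P a = a" "a \<in> A" if "a \<in> S" "a \<in> ball x (\<rho> / 4)" for a
  proof -
    have "g x = g a"
    proof (rule constant_if_quadratic_and_almost_midpoint_convex[where L = 2 and S = S and x = x and \<rho> = \<rho>])
      show "\<bar>g a - g b\<bar> \<le> 2 * (dist a b)\<^sup>2" if "a \<in> S \<inter> ball x \<rho>" "b \<in> S \<inter> ball x \<rho>" for a b
        using g_le[of a b] g_le[of b a] that by (simp add: dist_commute abs_le_iff)
    qed (use that \<open>x \<in> S\<close> \<open>\<rho> > 0\<close> almost_midpoint in auto)
    then show "P a = a" using \<open>P x = x\<close> by (simp add: g_def)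
    moreover have "a \<in> ball x \<rho>" using that \<open>\<rho> > 0\<close> by auto
    ultimately show "a \<in> A" using PA by metis
  qed

  define S' where "S' = S \<inter> ball x (\<rho> / 4)"
  have "x \<in> S'" using \<open>x \<in> S\<close> \<open>\<rho> > 0\<close> by (simp add: S'_def)
  have S'_ball: "p \<in> ball x \<rho>" if "p \<in> S'" for p using that \<open>\<rho> > 0\<close> by (auto simp: S'_def)
  have S': "G p = p" "p \<in> A" "p \<in> C" if "p \<in> S'" for p
    using that fixed[of p] in_A[of p] S'_ball[of p] by (auto simp: S'_def)
  define q where "q = sqrt ((1 - 7 * k / 16) / (1 - k / 4))"
  have "q < 1" "0 \<le> q" using k by (auto simp: q_def)
  have contract: "infdist w S' \<le> q * infdist y S'" and step: "dist y w \<le> (M + 1) * infdist y S'"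
    if "y \<in> ball x (\<rho> / 8)" "w \<in> T y" for y w
  proof -
    have y: "y \<in> ball x \<rho>" using that(1) \<open>\<rho> > 0\<close> by auto
    have w: "w = G y" using TG[OF y that(2)] .
    define d where "d = infdist y S'"
    define e where "e = infdist w S'"
    have de: "d \<ge> 0" "e \<ge> 0" by (simp_all add: d_def e_def infdist_nonneg)
    have "d \<le> infdist y S"
      using infdist_inter_ball_le[OF \<open>x \<in> S\<close>, of y "\<rho> / 4"] that(1) by (simp add: d_def S'_def)
    then have "min \<kappa> 1 * d \<le> \<kappa> * infdist y S"
      using \<open>\<kappa> > 0\<close> de by (intro mult_mono) auto
    also have "\<dots> \<le> norm (y - G y)" by (rule subreg[OF y])
    also have "\<dots> \<le> norm (y - P y) + norm (P y - w)"
      using norm_triangle_ineq[of "y - P y" "P y - w"] by (simp add: w)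
    finally have "(min \<kappa> 1 * d)\<^sup>2 \<le> (norm (y - P y) + norm (P y - w))\<^sup>2"
      using \<open>\<kappa> > 0\<close> de by (intro power_mono) auto
    also have "\<dots> \<le> 2 * (norm (y - P y))\<^sup>2 + 2 * (norm (P y - w))\<^sup>2"
      using sum_squares_bound[of "norm (y - P y)" "norm (P y - w)"] by (simp add: power2_sum)
    finally have gain: "k * d\<^sup>2 / 2 \<le> (norm (y - P y))\<^sup>2 + (norm (P y - w))\<^sup>2"
      by (simp add: k_def power_mult_distrib)
    have "(1 - k / 4) * e\<^sup>2 + 7 * k / 16 * d\<^sup>2 \<le> (norm (y - p))\<^sup>2" if "p \<in> S'" for p
    proof -
      have 1: "(1 - \<eta>) * (norm (P y - p))\<^sup>2 + (norm (y - P y))\<^sup>2 \<le> (norm (y - p))\<^sup>2"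
        using pythP[OF y S'(2)[OF that]] by (simp add: left_diff_distrib)
      have 2: "(1 - \<eta>) * (norm (w - p))\<^sup>2 + (norm (P y - w))\<^sup>2 \<le> (norm (P y - p))\<^sup>2"
        using pythQ[OF y S'(3)[OF that]] by (simp add: left_diff_distrib w)
      have 3: "e\<^sup>2 \<le> (norm (w - p))\<^sup>2"
        using infdist_le[OF that, of w] de by (intro power_mono) (auto simp: e_def dist_norm)
      have "(1 - \<eta>) * ((1 - \<eta>) * e\<^sup>2) + (1 - \<eta>) * (k * d\<^sup>2 / 2)
          \<le> (1 - \<eta>) * ((1 - \<eta>) * (norm (w - p))\<^sup>2) + (1 - \<eta>) * ((norm (y - P y))\<^sup>2 + (norm (P y - w))\<^sup>2)"
        using \<eta> gain 3 by (intro add_mono mult_left_mono) auto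
      also have "\<dots> = (1 - \<eta>) * ((1 - \<eta>) * (norm (w - p))\<^sup>2 + (norm (P y - w))\<^sup>2) + (1 - \<eta>) * (norm (y - P y))\<^sup>2"
        by (simp add: algebra_simps)
      also have "\<dots> \<le> (1 - \<eta>) * (norm (P y - p))\<^sup>2 + (norm (y - P y))\<^sup>2"
        using \<eta> 2 by (intro add_mono mult_left_mono mult_left_le_one_le) auto
      also note 1
      finally have 4: "(1 - \<eta>) * ((1 - \<eta>) * e\<^sup>2) + (1 - \<eta>) * (k * d\<^sup>2 / 2) \<le> (norm (y - p))\<^sup>2" .
      have "(1 - k / 4) * e\<^sup>2 \<le> (1 - \<eta>) * (1 - \<eta>) * e\<^sup>2"
        by (intro mult_right_mono) (simp_all add: \<eta>_def algebra_simps)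
      moreover have "7 * k / 16 * d\<^sup>2 \<le> (1 - \<eta>) * k / 2 * d\<^sup>2"
        using k by (intro mult_right_mono) (simp_all add: \<eta>_def)
      ultimately show ?thesis using 4 by (simp add: mult.assoc)
    qed
    then have "sqrt ((1 - k / 4) * e\<^sup>2 + 7 * k / 16 * d\<^sup>2) \<le> dist y p" if "p \<in> S'" for p
      using that by (simp add: dist_norm real_le_lsqrt)
    then have "sqrt ((1 - k / 4) * e\<^sup>2 + 7 * k / 16 * d\<^sup>2) \<le> d"
      unfolding d_def using \<open>x \<in> S'\<close> by (intro le_infdist) auto
    then have "(1 - k / 4) * e\<^sup>2 + 7 * k / 16 * d\<^sup>2 \<le> d\<^sup>2"
      by (rule sqrt_le_D)
    then have "e\<^sup>2 \<le> (1 - 7 * k / 16) / (1 - k / 4) * d\<^sup>2"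
      using k by (simp add: field_simps)
    then have "e \<le> sqrt ((1 - 7 * k / 16) / (1 - k / 4) * d\<^sup>2)" by (rule real_le_rsqrt)
    also have "\<dots> = q * d" unfolding real_sqrt_mult q_def using de by simp
    finally show "infdist w S' \<le> q * infdist y S'" by (simp add: d_def e_def)
    have "dist y w / (M + 1) \<le> infdist y S'"
    proof (rule le_infdist)
      fix p assume "p \<in> S'"
      have "dist y w \<le> dist y p + dist p w" by (rule dist_triangle)
      also have "dist p w \<le> M * dist y p"
        using Lip[OF S'_ball[OF \<open>p \<in> S'\<close>] y] S'(1)[OF \<open>p \<in> S'\<close>] by (simp add: w dist_norm norm_minus_commute)
      finally show "dist y w / (M + 1) \<le> dist y p"
        using \<open>M > 0\<close> by (simp add: field_simps)
    qed (use \<open>x \<in> S'\<close> in blast)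
    then show "dist y w \<le> (M + 1) * infdist y S'"
      using \<open>M > 0\<close> by (simp add: field_simps)
  qed
  have closure: "closure S' \<subseteq> A \<inter> C"
    using S' \<open>closed A\<close> \<open>closed C\<close> by (intro closure_minimal closed_Int) auto
  have "\<exists>\<epsilon>>0. \<forall>z :: nat \<Rightarrow> 'a. z 0 \<in> ball x \<epsilon> \<and> (\<forall>k. z (Suc k) \<in> T (z k)) \<longrightarrow>
      (\<exists>xb \<in> closure S'. R_linearly_converges z xb)"
    by (rule contracting_distance_imp_linear_convergence[where \<rho> = "\<rho> / 8" and K = "M + 1" and q = q])
       (use contract step \<open>x \<in> S'\<close> \<open>0 \<le> q\<close> \<open>q < 1\<close> \<open>\<rho> > 0\<close> \<open>M > 0\<close> in \<open>blast | simp\<close>)+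
  with closure show ?thesis by blast
qed

section \<open>The discrete Fourier transform as a similarity\<close>

lemma root_of_unity_orthogonality:
  assumes "a < N" "b < N"
  shows "(\<Sum>j<N. cis (- (2 * pi * real j * real a / real N)) * cnj (cis (- (2 * pi * real j * real b / real N))))
    = (if a = b then of_nat N else 0)"
proof -
  define z where "z = cis (2 * pi * (real b - real a) / real N)"
  have "N > 0" using assms by simp
  have geom: "cis (- (2 * pi * real j * real a / real N)) * cnj (cis (- (2 * pi * real j * real b / real N))) = z ^ j" for j
  proof -
    have "- (2 * pi * real j * real a / real N) + 2 * pi * real j * real b / real N
        = real j * (2 * pi * (real b - real a) / real N)"
      by (simp add: add_divide_distrib diff_divide_distrib algebra_simps)
    then show ?thesis by (simp add: z_def cis_cnj cis_mult Complex.DeMoivre)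
  qed
  show ?thesis
  proof (cases "a = b")
    case True
    then show ?thesis unfolding geom by (simp add: z_def)
  next
    case False
    have "z ^ N = cis (2 * pi * of_int (int b - int a))"
      using \<open>N > 0\<close> by (simp add: z_def Complex.DeMoivre)
    also have "\<dots> = 1" by (rule cis_multiple_2pi) simp
    finally have "z ^ N = 1" .
    have "z \<noteq> 1"
    proof
      assume "z = 1"
      then have "cos (2 * pi * (real b - real a) / real N) = 1"
        by (simp add: z_def complex_eq_iff)
      then obtain m :: int where "2 * pi * (real b - real a) / real N = of_int m * 2 * pi"
        by (auto simp: cos_one_2pi_int)
      then have "2 * pi * ((real b - real a) / real N - of_int m) = 0"
        by (simp add: algebra_simps)
      then have "(real b - real a) / real N = of_int m" by simp
      then have "real_of_int (int b - int a) = real_of_int (m * int N)"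
        using \<open>N > 0\<close> by (simp add: field_simps)
      then have "int b - int a = m * int N" by (simp only: of_int_eq_iff)
      then have "int N dvd int b - int a" by simp
      then have "int b mod int N = int a mod int N" by (simp add: mod_eq_dvd_iff)
      then show False using assms False by simp
    qed
    then show ?thesis
      unfolding geom using False \<open>z ^ N = 1\<close> by (simp add: geometric_sum)
  qed
qed

definition dft_kernel :: "('n::finite \<Rightarrow> nat) \<Rightarrow> 'n \<Rightarrow> 'n \<Rightarrow> complex" where
  "dft_kernel idx p k = cis (- (2 * pi * real (idx p) * real (idx k) / real CARD('n)))"

text \<open>
  Expanding the squares and summing over the frequencies first leaves the diagonal terms, by orthogonality
  of the characters.
\<close>

lemma dft_Parseval:
  fixes idx :: "'n::finite \<Rightarrow> nat" and v :: "'n \<Rightarrow> complex"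
  assumes idx: "bij_betw idx UNIV {0..<CARD('n)}"
  shows "(\<Sum>p\<in>UNIV. (cmod (\<Sum>k\<in>UNIV. v k * dft_kernel idx p k))\<^sup>2) = real CARD('n) * (\<Sum>k\<in>UNIV. (cmod (v k))\<^sup>2)"
proof -
  let ?e = "dft_kernel idx"
  have orth: "(\<Sum>p\<in>UNIV. ?e p k * cnj (?e p l)) = (if k = l then of_nat CARD('n) else 0)" for k l
  proof -
    have "idx k < CARD('n)" "idx l < CARD('n)"
      using bij_betwE[OF idx] by auto
    moreover have "idx k = idx l \<longleftrightarrow> k = l"
      using bij_betw_imp_inj_on[OF idx] by (auto dest: injD)
    moreover have "(\<Sum>p\<in>UNIV. ?e p k * cnj (?e p l)) =
        (\<Sum>j<CARD('n). cis (- (2 * pi * real j * real (idx k) / real CARD('n))) *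
          cnj (cis (- (2 * pi * real j * real (idx l) / real CARD('n)))))"
      unfolding dft_kernel_def using idx
      by (intro sum.reindex_bij_betw[of idx UNIV, where g = "\<lambda>j. cis (- (2 * pi * real j * real (idx k) / real CARD('n))) *
          cnj (cis (- (2 * pi * real j * real (idx l) / real CARD('n))))"]) (simp add: lessThan_atLeast0)
    ultimately show ?thesis by (simp only: root_of_unity_orthogonality)
  qed
  have "complex_of_real (\<Sum>p\<in>UNIV. (cmod (\<Sum>k\<in>UNIV. v k * ?e p k))\<^sup>2)
      = (\<Sum>p\<in>UNIV. (\<Sum>k\<in>UNIV. v k * ?e p k) * cnj (\<Sum>l\<in>UNIV. v l * ?e p l))"
    by (simp add: complex_norm_square del: of_real_power)
  also have "\<dots> = (\<Sum>p\<in>UNIV. \<Sum>k\<in>UNIV. \<Sum>l\<in>UNIV. v k * cnj (v l) * (?e p k * cnj (?e p l)))"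
    by (simp add: sum_product mult_ac)
  also have "\<dots> = (\<Sum>k\<in>UNIV. \<Sum>l\<in>UNIV. v k * cnj (v l) * (\<Sum>p\<in>UNIV. ?e p k * cnj (?e p l)))"
    unfolding sum_distrib_left by (subst sum.swap, rule sum.cong, simp, subst sum.swap) simp
  also have "\<dots> = (\<Sum>k\<in>UNIV. of_nat CARD('n) * (v k * cnj (v k)))"
    unfolding orth by (simp add: if_distrib sum.delta mult_ac cong: if_cong)
  also have "\<dots> = complex_of_real (real CARD('n) * (\<Sum>k\<in>UNIV. (cmod (v k))\<^sup>2))"
    by (simp add: sum_distrib_left complex_norm_square del: of_real_power)
  finally show ?thesis by (simp only: of_real_eq_iff)
qed

lemma norm_matrix_square: "(norm (x :: 'a::real_normed_vector^'n^'m))\<^sup>2 = (\<Sum>p\<in>UNIV. \<Sum>q\<in>UNIV. (norm (x $ p $ q))\<^sup>2)"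
  by (simp add: norm_vec_def L2_set_def sum_nonneg)

text \<open>
  The kernel is the product of two one-dimensional ones; Parseval's identity is applied to the columns
  and to the rows, each contributing a factor \<open>n\<close> that the normalisation \<open>c / n\<close> removes.
\<close>

lemma norm_dft2:
  fixes idx :: "'n::finite \<Rightarrow> nat" and x :: "complex^'n^'n"
  assumes idx: "bij_betw idx UNIV {0..<CARD('n)}"
  shows "norm (dft2 idx c x) = cmod c * norm x"
proof -
  let ?e = "dft_kernel idx"
  let ?N = "real CARD('n)"
  have entry: "dft2 idx c x $ p $ q = c / of_nat CARD('n) * (\<Sum>l\<in>UNIV. (\<Sum>k\<in>UNIV. x $ k $ l * ?e p k) * ?e q l)" for p q
  proof -
    have "exp (- (2 * of_real pi * \<i> * of_nat (idx p * idx k + idx q * idx l) / of_nat CARD('n))) = ?e p k * ?e q l" for k l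
      unfolding dft_kernel_def cis_conv_exp exp_add[symmetric]
      by (rule arg_cong[of _ _ exp]) (simp add: field_simps)
    then show ?thesis
      unfolding dft2_def vec_lambda_beta by (simp add: sum_distrib_right mult.assoc) (subst sum.swap, simp)
  qed
  have cmod_entry: "cmod (dft2 idx c x $ p $ q) =
      cmod c / ?N * cmod (\<Sum>l\<in>UNIV. (\<Sum>k\<in>UNIV. x $ k $ l * ?e p k) * ?e q l)" for p q
    by (simp only: entry norm_mult norm_divide norm_of_nat)
  have "(norm (dft2 idx c x))\<^sup>2 = (cmod c / ?N)\<^sup>2 *
      (\<Sum>p\<in>UNIV. \<Sum>q\<in>UNIV. (cmod (\<Sum>l\<in>UNIV. (\<Sum>k\<in>UNIV. x $ k $ l * ?e p k) * ?e q l))\<^sup>2)"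
    unfolding norm_matrix_square cmod_entry power_mult_distrib sum_distrib_left by (rule refl)
  also have "\<dots> = (cmod c / ?N)\<^sup>2 * (\<Sum>p\<in>UNIV. \<Sum>l\<in>UNIV. ?N * (cmod (\<Sum>k\<in>UNIV. x $ k $ l * ?e p k))\<^sup>2)"
    by (simp add: dft_Parseval[OF idx] sum_distrib_left)
  also have "\<dots> = (cmod c / ?N)\<^sup>2 * (\<Sum>l\<in>UNIV. ?N * (\<Sum>p\<in>UNIV. (cmod (\<Sum>k\<in>UNIV. x $ k $ l * ?e p k))\<^sup>2))"
    by (subst sum.swap) (simp add: sum_distrib_left)
  also have "\<dots> = (cmod c / ?N)\<^sup>2 * (?N * ?N * (\<Sum>l\<in>UNIV. \<Sum>k\<in>UNIV. (cmod (x $ k $ l))\<^sup>2))"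
    by (simp add: dft_Parseval[OF idx] sum_distrib_left mult.assoc)
  also have "\<dots> = (cmod c * norm x)\<^sup>2"
    unfolding norm_matrix_square power_mult_distrib
    by (subst sum.swap) (simp add: power2_eq_square field_simps)
  finally show ?thesis by (simp add: power2_eq_iff_nonneg)
qed

lemma linear_dft2: "linear (dft2 idx c)"
  by (rule linearI)
     (simp_all add: dft2_def vec_eq_iff distrib_right sum.distrib distrib_left scaleR_sum_right[symmetric])

lemma norm_hadamard_expj: "norm (x \<odot> expj \<Phi>) = norm x"
  by (simp add: norm_vec_def L2_set_def hadamard_def expj_def norm_mult)

section \<open>The constraint sets near a solution\<close>

lemma closed_matrix_box:
  fixes A :: "'m::finite \<Rightarrow> 'n::finite \<Rightarrow> 'a::topological_space set"
  assumes "\<And>p q. closed (A p q)"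
  shows "closed {y :: 'a^'n^'m. \<forall>p q. y $ p $ q \<in> A p q}"
proof -
  have "closed {y :: 'a^'n^'m. \<forall>p. y $ p \<in> {v. \<forall>q. v $ q \<in> A p q}}"
    by (intro closed_vector_box allI assms)
  then show ?thesis by simp
qed

lemma proj_self: "x \<in> S \<Longrightarrow> x \<in> proj S x"
  by (simp add: proj_def infdist_zero)

text \<open>
  A nearest point of \<open>S\<close> to \<open>z\<close> is at most twice as far from \<open>x\<close> as \<open>z\<close> is, so projecting near \<open>x\<close> sees only
  the part of \<open>S\<close> near \<open>x\<close>.
\<close>

lemma eventually_proj_subset:
  assumes "x \<in> S" and "C \<subseteq> S" and "x \<in> C" and local: "\<forall>\<^sub>F w in nhds x. w \<in> S \<longrightarrow> w \<in> C"
  shows "\<forall>\<^sub>F z in nhds x. proj S z \<subseteq> proj C z"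
proof -
  obtain d where "d > 0" and d: "\<And>w. dist w x < d \<Longrightarrow> w \<in> S \<Longrightarrow> w \<in> C"
    using local by (auto simp: eventually_nhds_metric)
  have "w \<in> proj C z" if z: "dist z x < d / 2" and w: "w \<in> proj S z" for z w
  proof -
    have "w \<in> S" and wz: "dist z w = infdist z S" using w by (auto simp: proj_def)
    have "dist z w \<le> dist z x" using infdist_le[OF \<open>x \<in> S\<close>, of z] wz by simp
    then have "dist w x < d" using z dist_triangle[of w x z] by (simp add: dist_commute)
    with d \<open>w \<in> S\<close> have "w \<in> C" by blast
    moreover have "dist z w = infdist z C"
      using infdist_mono[OF \<open>C \<subseteq> S\<close>, of z] infdist_le[OF \<open>w \<in> C\<close>, of z] \<open>x \<in> C\<close> wz by fastforce
    ultimately show ?thesis by (simp add: proj_def)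
  qed
  then show ?thesis
    unfolding eventually_nhds_metric using \<open>d > 0\<close> by (intro exI[of _ "d / 2"]) auto
qed

lemma Arg_eq_0_iff_of_real_cmod: "Arg z = 0 \<longleftrightarrow> z = of_real (cmod z)"
proof
  assume "Arg z = 0"
  then show "z = of_real (cmod z)" using rcis_cmod_Arg[of z] by (simp add: rcis_def)
next
  assume "z = of_real (cmod z)"
  then show "Arg z = 0" by (metis Arg_eq_0 Re_complex_of_real Reals_of_real norm_ge_zero)
qed

text \<open>
  The matrices with entries of modulus \<open>r\<close> whose phase is supported in the phase support of \<open>x\<close>.
\<close>

definition circles_and_points :: "real \<Rightarrow> complex^'n^'n \<Rightarrow> (complex^'n^'n) set" where
  "circles_and_points r x =
     {y. \<forall>p q. y $ p $ q \<in> (if Arg (x $ p $ q) = 0 then {of_real r} else sphere 0 r)}"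

text \<open>
  A nonzero phase stays nonzero under small perturbations, because the nonnegative real axis is closed (in
  particular the jump of \<open>Arg\<close> at the negative axis is harmless). Since the bound \<open>s\<close> is attained at \<open>x\<close>, a
  point of \<open>\<Omega>3\<close> near \<open>x\<close> has no room for further nonzero phases and has exactly the phase support of \<open>x\<close>.
\<close>

lemma \<Omega>3_locally_circles_and_points:
  fixes x :: "complex^'n^'n"
  assumes X: "\<And>p q. X $ p $ q = r" and "r \<ge> 0" and s: "s = l0 (map_matrix Arg x)" and "x \<in> \<Omega>3 X s"
  shows "circles_and_points r x \<subseteq> \<Omega>3 X s" and "x \<in> circles_and_points r x"
    and "\<forall>\<^sub>F w in nhds x. w \<in> \<Omega>3 X s \<longrightarrow> w \<in> circles_and_points r x"
proof -
  have norm: "cmod (w $ p $ q) = r" if "w \<in> \<Omega>3 X s" for w p q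
    using that X by (simp add: \<Omega>3_def \<Omega>2_def vec_eq_iff)
  define I where "I = (\<lambda>y :: complex^'n^'n. {(p, q). Arg (y $ p $ q) \<noteq> 0})"
  have l0_I: "l0 (map_matrix Arg y) = card (I y)" for y
    by (simp add: l0_def I_def)
  have fin: "finite (I y)" for y by (rule finite)
  show "circles_and_points r x \<subseteq> \<Omega>3 X s"
  proof
    fix y assume y: "y \<in> circles_and_points r x"
    have entry: "y $ p $ q \<in> (if Arg (x $ p $ q) = 0 then {of_real r} else sphere 0 r)" for p q
      using y unfolding circles_and_points_def by blast
    have "cmod (y $ p $ q) = r" for p q
      using entry[of p q] \<open>r \<ge> 0\<close> by (auto split: if_splits)
    moreover have "I y \<subseteq> I x"
    proof -
      have "Arg (y $ p $ q) = 0" if "Arg (x $ p $ q) = 0" for p q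
      proof -
        have "y $ p $ q = of_real r" using entry[of p q] that by simp
        then show ?thesis using \<open>r \<ge> 0\<close> by (simp add: Arg_eq_0)
      qed
      then show ?thesis by (auto simp: I_def)
    qed
    then have "card (I y) \<le> card (I x)" by (intro card_mono fin)
    ultimately show "y \<in> \<Omega>3 X s"
      using X by (simp add: \<Omega>3_def \<Omega>2_def vec_eq_iff l0_I s)
  qed
  show "x \<in> circles_and_points r x"
    unfolding circles_and_points_def using norm[OF \<open>x \<in> \<Omega>3 X s\<close>]
    by (auto simp: Arg_eq_0_iff_of_real_cmod)
  have "\<forall>\<^sub>F w in nhds x. \<forall>p\<in>UNIV. \<forall>q\<in>UNIV. Arg (x $ p $ q) \<noteq> 0 \<longrightarrow> Arg (w $ p $ q) \<noteq> 0"
  proof (intro eventually_ball_finite ballI finite)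
    fix p q
    show "\<forall>\<^sub>F w in nhds x. Arg (x $ p $ q) \<noteq> 0 \<longrightarrow> Arg (w $ p $ q) \<noteq> 0"
    proof (cases "Arg (x $ p $ q) = 0")
      case False
      have iff: "Arg z = 0 \<longleftrightarrow> z \<in> \<real>\<^sub>\<ge>\<^sub>0" for z by (simp add: Arg_eq_0 complex_nonneg_Reals_iff complex_is_Real_iff conj_commute)
      have "open ((\<lambda>w :: complex^'n^'n. w $ p $ q) -` (- \<real>\<^sub>\<ge>\<^sub>0))"
        by (intro open_vimage continuous_intros) (simp add: closed_nonneg_Reals_complex open_Compl)
      from eventually_nhds_in_open[OF this, of x]
      have "\<forall>\<^sub>F w in nhds x. w $ p $ q \<notin> \<real>\<^sub>\<ge>\<^sub>0" using False by (simp add: iff)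
      then show ?thesis by (rule eventually_mono) (simp add: iff)
    qed simp
  qed
  then show "\<forall>\<^sub>F w in nhds x. w \<in> \<Omega>3 X s \<longrightarrow> w \<in> circles_and_points r x"
  proof (eventually_elim, intro impI)
    fix w assume w: "\<forall>p\<in>UNIV. \<forall>q\<in>UNIV. Arg (x $ p $ q) \<noteq> 0 \<longrightarrow> Arg (w $ p $ q) \<noteq> 0" "w \<in> \<Omega>3 X s"
    have "I x \<subseteq> I w" using w(1) by (auto simp: I_def)
    moreover have "card (I w) \<le> card (I x)" using w(2) by (simp add: \<Omega>3_def l0_I s)
    ultimately have "I x = I w" by (intro card_seteq fin)
    then have "Arg (w $ p $ q) = 0" if "Arg (x $ p $ q) = 0" for p q
      using that unfolding I_def by blast
    then show "w \<in> circles_and_points r x"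
      unfolding circles_and_points_def using norm[OF w(2)]
      by (auto simp: Arg_eq_0_iff_of_real_cmod)
  qed
qed

section \<open>Sparse phase retrieval\<close>

text \<open>
  The transform preceded by the modulation with \<open>expj \<Phi>d\<close> is a similarity \<open>U\<close>, which maps \<open>\<Omega>1\<close> onto a product
  of circles. Near \<open>xs\<close> the three projections are the explicit maps \<open>P\<close>, \<open>R\<close>, \<open>Q\<close>, where \<open>Q\<close> already contains
  the normalisation done by \<open>R\<close>; so the iteration is the alternating projection between \<open>\<Omega>1\<close> and a product
  of circles and points.
\<close>

theorem theorem2:
  fixes idx :: "'n::finite \<Rightarrow> nat" and c :: complex and r :: real
    and X \<Phi>d b \<Phi>s :: "real^'n^'n" and s :: nat and xs :: "complex^'n^'n"
    and F :: "complex^'n^'n \<Rightarrow> complex^'n^'n"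
  assumes "bij_betw idx UNIV {0..<CARD('n)}" and "c \<noteq> 0"
    and "F = dft2 idx c"
    and "r > 0" and "\<forall>p q. X $ p $ q = r"
    and "\<forall>p q. b $ p $ q \<ge> 0"
    and "sparsest_phase_solution F X \<Phi>d b \<Phi>s"
    and "s = l0 \<Phi>s"
    and "xs = map_matrix of_real X \<odot> expj \<Phi>s"
    and "metrically_subregular (id_minus (T F X \<Phi>d b s)) xs 0"
  shows "\<exists>\<epsilon>>0. \<forall>x :: nat \<Rightarrow> complex^'n^'n.
    x 0 \<in> ball xs \<epsilon> \<and> (\<forall>k. x (Suc k) \<in> T F X \<Phi>d b s (x k)) \<longrightarrow>
    (\<exists>xb \<in> \<Omega>1 F \<Phi>d b \<inter> \<Omega>2 X \<inter> \<Omega>3 X s. R_linearly_converges x xb)"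
proof -
  have X: "X $ p $ q = r" for p q using assms(5) by blast
  have sol: "phase_solution F X \<Phi>d b s \<Phi>s"
    using assms(7,8) by (simp add: phase_solution_def sparsest_phase_solution_def)
  have "xs \<in> \<Omega>1 F \<Phi>d b \<inter> \<Omega>2 X \<inter> \<Omega>3 X s"
    using sol assms(4,9) by (subst in_\<Omega>_iff_phase_solution) (auto simp: X)
  then have xs: "xs \<in> \<Omega>1 F \<Phi>d b" "xs \<in> \<Omega>2 X" "xs \<in> \<Omega>3 X s" by auto
  have "Arg (xs $ p $ q) = \<Phi>s $ p $ q" for p q
    using sol assms(4) unfolding assms(9)
    by (intro Arg_unique'[of r])
       (auto simp: phase_solution_def phase_feasible_def hadamard_def expj_def X rcis_def cis_conv_exp)
  then have s: "s = l0 (map_matrix Arg xs)" by (simp add: assms(8) l0_def)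
  have "r \<ge> 0" using \<open>r > 0\<close> by simp

  define U where "U = (\<lambda>x. F (x \<odot> expj \<Phi>d))"
  have norm_U: "norm (U x) = cmod c * norm x" for x
    by (simp add: U_def \<open>F = dft2 idx c\<close> norm_dft2[OF assms(1)] norm_hadamard_expj)
  have "linear (\<lambda>x :: complex^'n^'n. x \<odot> expj \<Phi>d)"
    by (rule linearI) (simp_all add: hadamard_def vec_eq_iff distrib_right)
  from linear_compose[OF this linear_dft2] have "linear U"
    by (simp add: U_def o_def \<open>F = dft2 idx c\<close>)
  have "x = 0" if "U x = 0" for x
    using norm_U[of x] \<open>c \<noteq> 0\<close> that by simp
  with \<open>linear U\<close> have "inj U" by (simp add: linear_injective_0)
  with \<open>linear U\<close> have "surj U" by (intro eucl.linear_injective_imp_surjective) auto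

  define B where "B = {u :: complex^'n^'n. \<forall>p q. u $ p $ q \<in> sphere 0 (sqrt (b $ p $ q))}"
  have \<Omega>1_eq: "\<Omega>1 F \<Phi>d b = U -` B"
  proof -
    have "(cmod z)\<^sup>2 = b $ p $ q \<longleftrightarrow> cmod z = sqrt (b $ p $ q)" for z p q
      using assms(6) by (metis norm_ge_zero real_sqrt_pow2 real_sqrt_unique)
    then show ?thesis by (auto simp: \<Omega>1_def B_def U_def vec_eq_iff)
  qed
  define P where "P = (\<lambda>y. inv U (\<chi> p q. sqrt (b $ p $ q) *\<^sub>R sgn (U y $ p $ q)))"
  have P: "pythagorean_projection P (\<Omega>1 F \<Phi>d b) xs"
    unfolding \<Omega>1_eq P_def
  proof (rule pythagorean_projection_vimage[OF \<open>linear U\<close> \<open>surj U\<close> _ norm_U])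
    show "pythagorean_projection (\<lambda>u. \<chi> p q. sqrt (b $ p $ q) *\<^sub>R sgn (u $ p $ q)) B (U xs)"
      unfolding B_def
      by (intro pythagorean_projection_matrix pythagorean_projection_sphere)
         (use xs(1) in \<open>auto simp: \<Omega>1_eq B_def\<close>)
  qed (use \<open>c \<noteq> 0\<close> in simp)

  define R where "R = (\<lambda>y :: complex^'n^'n. \<chi> p q. r *\<^sub>R sgn (y $ p $ q))"
  have \<Omega>2_eq: "\<Omega>2 X = {y. \<forall>p q. y $ p $ q \<in> sphere 0 r}"
    by (auto simp: \<Omega>2_def vec_eq_iff X)
  have R: "pythagorean_projection R (\<Omega>2 X) xs"
    unfolding R_def \<Omega>2_eq
    by (intro pythagorean_projection_matrix pythagorean_projection_sphere) (use xs(2) in \<open>auto simp: \<Omega>2_eq\<close>)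

  let ?C = "circles_and_points r xs"
  note C = \<Omega>3_locally_circles_and_points[OF X \<open>r \<ge> 0\<close> s xs(3)]
  define Q where "Q = (\<lambda>y :: complex^'n^'n. \<chi> p q.
    (if Arg (xs $ p $ q) = 0 then (\<lambda>_. of_real r) else (\<lambda>v. r *\<^sub>R sgn v)) (y $ p $ q))"
  have Q: "pythagorean_projection Q ?C xs"
    unfolding Q_def circles_and_points_def
  proof (rule pythagorean_projection_matrix)
    fix p q
    have "norm (xs $ p $ q) = r" using xs(2) by (auto simp: \<Omega>2_eq)
    then show "pythagorean_projection (if Arg (xs $ p $ q) = 0 then (\<lambda>_. of_real r) else (\<lambda>v. r *\<^sub>R sgn v))
        (if Arg (xs $ p $ q) = 0 then {of_real r} else sphere 0 r) (xs $ p $ q)"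
      using pythagorean_projection_point pythagorean_projection_sphere by auto
  qed
  have QR: "Q (R y) = Q y" for y
  proof -
    have "sgn (r *\<^sub>R sgn v) = sgn v" for v :: complex
      using \<open>r > 0\<close> by (simp add: sgn_scaleR)
    then show ?thesis by (simp add: Q_def R_def vec_eq_iff)
  qed

  note limP = pythagorean_projection_filterlim[OF P xs(1)]
    and limR = pythagorean_projection_filterlim[OF R xs(2)]
  have T_eq: "\<forall>\<^sub>F y in nhds xs. T F X \<Phi>d b s y \<subseteq> {Q (P y)}"
    using pythagorean_projection_unique[OF P]
      eventually_compose_filterlim[OF pythagorean_projection_unique[OF R] limP]
      eventually_compose_filterlim[OF eventually_compose_filterlim[OF
        eventually_conj[OF eventually_proj_subset[OF xs(3) C(1,2,3)] pythagorean_projection_unique[OF Q]] limR] limP]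
  proof eventually_elim
    case (elim y)
    show ?case
    proof
      fix w assume "w \<in> T F X \<Phi>d b s y"
      then obtain y' z where "y' \<in> proj (\<Omega>1 F \<Phi>d b) y" "z \<in> proj (\<Omega>2 X) y'" "w \<in> proj (\<Omega>3 X s) z"
        by (auto simp: T_def)
      with elim show "w \<in> {Q (P y)}" using QR by blast
    qed
  qed
  have "\<exists>\<epsilon>>0. \<forall>x :: nat \<Rightarrow> complex^'n^'n.
    x 0 \<in> ball xs \<epsilon> \<and> (\<forall>k. x (Suc k) \<in> T F X \<Phi>d b s (x k)) \<longrightarrow>
    (\<exists>xb \<in> \<Omega>1 F \<Phi>d b \<inter> ?C. R_linearly_converges x xb)"
  proof (rule alternating_projections_linear_convergence[OF _ _ xs(1) C(2) P Q T_eq _ assms(10)])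
    have "closed B" unfolding B_def by (intro closed_matrix_box closed_sphere)
    then show "closed (\<Omega>1 F \<Phi>d b)"
      unfolding \<Omega>1_eq using \<open>linear U\<close>
      by (intro closed_vimage linear_continuous_on) (simp_all add: linear_conv_bounded_linear)
    show "closed ?C"
      unfolding circles_and_points_def by (intro closed_matrix_box) auto
    show "xs \<in> T F X \<Phi>d b s xs"
      using xs by (auto simp: T_def intro!: bexI[of _ xs] proj_self)
  qed
  moreover have "?C \<subseteq> \<Omega>2 X \<inter> \<Omega>3 X s" using C(1) by (auto simp: \<Omega>3_def)
  ultimately show ?thesis by blast
qed

end
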